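(* For any $s\in\mathbb{R}$ and $t\in\mathbb{R}_{+}\setminus\{1/2\}$, the 2-parameter family of $G$-invariant metric connections $\nabla^{s,t}$ on $(M=G/K,\mathfrak{m}_1\oplus\mathfrak{m}_2,g_t)$ has torsion of mixed type $\mathcal{A}_{2}\oplus\mathcal{A}_{3}$. For $t=1/2$ it reduces to a 1-parameter family of metric connections with skew-torsion.
   Context: $G$ is a compact connected semisimple Lie group, $K\subset G$ a closed connected subgroup, with Lie algebras $\mathfrak{g},\mathfrak{k}$; $M=G/K$ is connected of dimension $n\ge 3$; $B$ is the negative of the Killing form of $\mathfrak{g}$; $\mathfrak{g}=\mathfrak{k}\oplus\mathfrak{m}$ is the $B$-orthogonal reductive decomposition, $\mathfrak{m}\cong T_oM$. It is assumed that $\mathfrak{m}=\mathfrak{m}_1\oplus\mathfrak{m}_2$ is a $B$-orthogonal decomposition into two non-trivial, irreducible, inequivalent $\mathrm{Ad}(K)$-submodules such that $[\mathfrak{k},\mathfrak{m}_i]\subset\mathfrak{m}_i$, $[\mathfrak{m}_1,\mathfrak{m}_1]\subset\mathfrak{k}\oplus\mathfrak{m}_2$, $[\mathfrak{m}_1,\mathfrak{m}_2]\subset\mathfrak{m}_1$, $[\mathfrak{m}_2,\mathfrak{m}_2]\subset\mathfrak{k}$. For $t>0$, $g_t=B|_{\mathfrak{m}_1\times\mathfrak{m}_1}+2t\,B|_{\mathfrak{m}_2\times\mathfrak{m}_2}$ is the corresponding $G$-invariant metric. $G$-invariant connections correspond to their Nomizu maps $\Lambda:\mathfrak{m}\to\mathfrak{gl}(\mathfrak{m})$,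 with torsion $T(X,Y)=\Lambda(X)Y-\Lambda(Y)X-[X,Y]_{\mathfrak{m}}$. The Levi-Civita connection $\nabla^t$ of $g_t$ has Nomizu map $\Lambda_t$ given by $\Lambda_t(X)Y=\frac12[X,Y]_{\mathfrak{m}_2}$ for $X,Y\in\mathfrak{m}_1$; $\Lambda_t(X)Y=t[X,Y]$ for $X\in\mathfrak{m}_1,Y\in\mathfrak{m}_2$; $\Lambda_t(X)Y=(1-t)[X,Y]$ for $X\in\mathfrak{m}_2,Y\in\mathfrak{m}_1$; $\Lambda_t(X)Y=0$ for $X,Y\in\mathfrak{m}_2$. For $s\in\mathbb{R}$, $t>0$, $\nabla^{s,t}$ is the $G$-invariant metric connection with Nomizu map $\Lambda_{s,t}=s\Lambda_t$. For a Riemannian manifold $(M,g)$ let $\mathcal{A}^g=\{A\in\otimes^3TM: A(X,Y,Z)+A(X,Z,Y)=0\}$ and $\Phi(A)(Z)=\sum_iA(e_i,e_i,Z)$ for an orthonormal frame $\{e_i\}$. Then $\mathcal{A}^g=\mathcal{A}_1\oplus\mathcal{A}_2\oplus\mathcal{A}_3$, where $\mathcal{A}_1$ consists of the $A$ with $A(X,Y,Z)=g(X,Y)g(V,Z)-g(V,Y)g(X,Z)$ for a vector field $V$, $\mathcal{A}_2$ of the $A$ with $A(X,Y,Z)+A(Y,X,Z)=0$, and $\mathcal{A}_3$ of the $A$ with vanishing cyclic sum over $X,Y,Z$ and $\Phi(A)=0$. The torsion of a metric connection $\nabla$ is said to be of a given type ($\mathcal{A}_2$ is totally skew-symmetric,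 or skew-torsion) if $A(X,Y,Z)=g(\nabla_XY-\nabla^g_XY,Z)$ belongs to the corresponding subspace, $\nabla^g$ being the Levi-Civita connection; mixed type $\mathcal{A}_2\oplus\mathcal{A}_3$ means $A\in\mathcal{A}_2\oplus\mathcal{A}_3$. *)

theory Defs
  imports "HOL-Analysis.Analysis" "HOL-Algebra.Group"
begin

text \<open>On an open subset of a finite-dimensional space, \<^term>\<open>S\<close> say, having all iterated
  directional derivatives up to order \<^term>\<open>k\<close>, all of them continuous, is being of class
  $C^k$.\<close>

primrec Ck_on ::
  "nat \<Rightarrow> 'a::real_normed_vector set \<Rightarrow> ('a \<Rightarrow> 'b::real_normed_vector) \<Rightarrow> bool" where
  "Ck_on 0 S f \<longleftrightarrow> continuous_on S f"
| "Ck_on (Suc k) S f \<longleftrightarrow>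
     (\<forall>x\<in>S. f differentiable (at x)) \<and> (\<forall>v. Ck_on k S (\<lambda>x. frechet_derivative f (at x) v))"

definition smooth_on ::
  "'a::real_normed_vector set \<Rightarrow> ('a \<Rightarrow> 'b::real_normed_vector) \<Rightarrow> bool" where
  "smooth_on S f \<longleftrightarrow> (\<forall>k. Ck_on k S f)"

type_synonym ('g, 'd) chart = "'g set \<times> ('g \<Rightarrow> real^'d)"

text \<open>A chart is a pair consisting of its domain and its coordinate map, which is meaningful
  only on the domain.\<close>

definition chart_inv :: "('g, 'd) chart \<Rightarrow> real^'d \<Rightarrow> 'g" where
  "chart_inv c = inv_into (fst c) (snd c)"

definition smooth_atlas :: "'g topology \<Rightarrow> ('g, 'd::finite) chart set \<Rightarrow> bool" where
  "smooth_atlas T \<A> \<longleftrightarrow>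
     Hausdorff_space T \<and> second_countable T \<and>
     topspace T = (\<Union>c\<in>\<A>. fst c) \<and>
     (\<forall>c\<in>\<A>. openin T (fst c) \<and> open (snd c ` fst c) \<and>
        homeomorphic_map (subtopology T (fst c)) (top_of_set (snd c ` fst c)) (snd c)) \<and>
     (\<forall>c\<in>\<A>. \<forall>c'\<in>\<A>. smooth_on (snd c ` (fst c \<inter> fst c')) (\<lambda>x. snd c' (chart_inv c x)))"

locale lie_group = group G
  for G :: "'g monoid" (structure) +
  fixes T :: "'g topology" and \<A> :: "('g, 'd::finite) chart set"
  assumes atlas: "smooth_atlas T \<A>"
    and topspace_eq: "topspace T = carrier G"
    and continuous_mult: "continuous_map (prod_topology T T) T (\<lambda>(x, y). x \<otimes> y)"
    and continuous_inv: "continuous_map T T (\<lambda>x. inv x)"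
    and smooth_mult: "\<lbrakk>c1 \<in> \<A>; c2 \<in> \<A>; c3 \<in> \<A>\<rbrakk> \<Longrightarrow>
      smooth_on {(x, y). x \<in> snd c1 ` fst c1 \<and> y \<in> snd c2 ` fst c2 \<and>
                         chart_inv c1 x \<otimes> chart_inv c2 y \<in> fst c3}
        (\<lambda>(x, y). snd c3 (chart_inv c1 x \<otimes> chart_inv c2 y))"
    and smooth_inv: "\<lbrakk>c1 \<in> \<A>; c2 \<in> \<A>\<rbrakk> \<Longrightarrow>
      smooth_on {x \<in> snd c1 ` fst c1. inv (chart_inv c1 x) \<in> fst c2}
        (\<lambda>x. snd c2 (inv (chart_inv c1 x)))"

text \<open>For a chart \<^term>\<open>c\<close> around the identity, the differential of the coordinate map identifies
  the tangent space at the identity, that is the Lie algebra, with the model space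
  \<^typ>\<open>real^'d\<close>. The point of the model space corresponding to the identity need not be 0.\<close>

definition chart_one :: "'g monoid \<Rightarrow> ('g, 'd) chart \<Rightarrow> real^'d" where
  "chart_one G c = snd c \<one>\<^bsub>G\<^esub>"

text \<open>Coordinate expression, at the point with coordinates \<^term>\<open>y\<close>, of the left-invariant vector
  field whose value at the identity is \<^term>\<open>X\<close>.\<close>

definition left_invariant_field ::
  "'g monoid \<Rightarrow> ('g, 'd::finite) chart \<Rightarrow> real^'d \<Rightarrow> real^'d \<Rightarrow> real^'d" where
  "left_invariant_field G c X y =
     frechet_derivative (\<lambda>z. snd c (chart_inv c y \<otimes>\<^bsub>G\<^esub> chart_inv c z)) (at (chart_one G c)) X"

text \<open>The value at the identity of the commutator of two left-invariant fields; in coordinates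
  the commutator of fields \<open>V\<close>, \<open>W\<close> is \<open>DW(V) - DV(W)\<close>.\<close>

definition lie_bracket ::
  "'g monoid \<Rightarrow> ('g, 'd::finite) chart \<Rightarrow> real^'d \<Rightarrow> real^'d \<Rightarrow> real^'d" where
  "lie_bracket G c X Y =
     frechet_derivative (left_invariant_field G c Y) (at (chart_one G c)) X -
     frechet_derivative (left_invariant_field G c X) (at (chart_one G c)) Y"

definition adjoint_rep ::
  "'g monoid \<Rightarrow> ('g, 'd::finite) chart \<Rightarrow> 'g \<Rightarrow> real^'d \<Rightarrow> real^'d" where
  "adjoint_rep G c a X =
     frechet_derivative (\<lambda>x. snd c (a \<otimes>\<^bsub>G\<^esub> chart_inv c x \<otimes>\<^bsub>G\<^esub> inv\<^bsub>G\<^esub> a)) (at (chart_one G c)) X"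

text \<open>The Lie algebra of a closed subgroup \<^term>\<open>K\<close>: velocities at the identity of the smooth
  curves of the ambient group that lie in \<^term>\<open>K\<close>.\<close>

definition lie_algebra_of ::
  "'g monoid \<Rightarrow> ('g, 'd::finite) chart \<Rightarrow> 'g set \<Rightarrow> (real^'d) set" where
  "lie_algebra_of G c K =
     {X. \<exists>\<gamma> \<epsilon>. \<epsilon> > 0 \<and> \<gamma> 0 = \<one>\<^bsub>G\<^esub> \<and> (\<forall>r\<in>{-\<epsilon><..<\<epsilon>}. \<gamma> r \<in> K \<inter> fst c) \<and>
        smooth_on {-\<epsilon><..<\<epsilon>} (\<lambda>r::real. snd c (\<gamma> r)) \<and>
        ((\<lambda>r. snd c (\<gamma> r)) has_vector_derivative X) (at 0)}"

definition killing_form ::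
  "(real^'d \<Rightarrow> real^'d \<Rightarrow> real^'d) \<Rightarrow> real^'d \<Rightarrow> real^'d::finite \<Rightarrow> real" where
  "killing_form br X Y = trace (matrix (\<lambda>Z. br X (br Y Z)))"

text \<open>Semisimplicity in the sense of Helgason: the Killing form is nondegenerate.\<close>

definition semisimple_bracket :: "(real^'d \<Rightarrow> real^'d \<Rightarrow> real^'d::finite) \<Rightarrow> bool" where
  "semisimple_bracket br \<longleftrightarrow> (\<forall>X. (\<forall>Y. killing_form br X Y = 0) \<longrightarrow> X = 0)"

definition direct_sum_decomp ::
  "'v::real_vector set \<Rightarrow> 'v set \<Rightarrow> 'v set \<Rightarrow> bool" where
  "direct_sum_decomp S V W \<longleftrightarrow> subspace V \<and> subspace W \<and> V \<inter> W = {0} \<and> V + W = S"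

text \<open>The component of \<^term>\<open>X\<close> in \<^term>\<open>V\<close> along \<^term>\<open>W\<close>.\<close>

definition component :: "'v::real_vector set \<Rightarrow> 'v set \<Rightarrow> 'v \<Rightarrow> 'v" where
  "component V W X = (THE u. u \<in> V \<and> X - u \<in> W)"

definition submodule_under :: "('g \<Rightarrow> 'v \<Rightarrow> 'v) \<Rightarrow> 'g set \<Rightarrow> 'v::real_vector set \<Rightarrow> bool" where
  "submodule_under \<rho> K V \<longleftrightarrow> subspace V \<and> (\<forall>k\<in>K. \<forall>X\<in>V. \<rho> k X \<in> V)"

definition irreducible_submodule ::
  "('g \<Rightarrow> 'v \<Rightarrow> 'v) \<Rightarrow> 'g set \<Rightarrow> 'v::real_vector set \<Rightarrow> bool" where
  "irreducible_submodule \<rho> K V \<longleftrightarrow>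
     submodule_under \<rho> K V \<and> V \<noteq> {0} \<and>
     (\<forall>W. submodule_under \<rho> K W \<and> W \<subseteq> V \<longrightarrow> W = {0} \<or> W = V)"

definition equivalent_submodules ::
  "('g \<Rightarrow> 'v \<Rightarrow> 'v) \<Rightarrow> 'g set \<Rightarrow> 'v::real_vector set \<Rightarrow> 'v set \<Rightarrow> bool" where
  "equivalent_submodules \<rho> K V W \<longleftrightarrow>
     (\<exists>f. linear f \<and> bij_betw f V W \<and> (\<forall>k\<in>K. \<forall>X\<in>V. f (\<rho> k X) = \<rho> k (f X)))"

text \<open>An invariant connection on $G/K$ is given by its Nomizu map on \<open>\<mm>\<close>, and an invariant
  tensor field by its value on \<open>\<mm>\<close>, the tangent space at the base point. Nomizu maps and
  tensors on \<open>\<mm>\<close> are functions on the whole Lie algebra whose values outside \<open>\<mm>\<close> are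
  irrelevant.\<close>

definition linear_on_set :: "'v::real_vector set \<Rightarrow> ('v \<Rightarrow> 'w::real_vector) \<Rightarrow> bool" where
  "linear_on_set V f \<longleftrightarrow>
     (\<forall>X\<in>V. \<forall>Y\<in>V. f (X + Y) = f X + f Y) \<and> (\<forall>r. \<forall>X\<in>V. f (r *\<^sub>R X) = r *\<^sub>R f X)"

definition nomizu_map ::
  "('g \<Rightarrow> 'v \<Rightarrow> 'v) \<Rightarrow> 'g set \<Rightarrow> 'v::real_vector set \<Rightarrow> ('v \<Rightarrow> 'v \<Rightarrow> 'v) \<Rightarrow> bool" where
  "nomizu_map \<rho> K \<mm> \<Lambda> \<longleftrightarrow>
     (\<forall>X\<in>\<mm>. \<forall>Y\<in>\<mm>. \<Lambda> X Y \<in> \<mm>) \<and>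
     (\<forall>X\<in>\<mm>. linear_on_set \<mm> (\<lambda>Y. \<Lambda> X Y)) \<and>
     (\<forall>Y\<in>\<mm>. linear_on_set \<mm> (\<lambda>X. \<Lambda> X Y)) \<and>
     (\<forall>k\<in>K. \<forall>X\<in>\<mm>. \<forall>Y\<in>\<mm>. \<Lambda> (\<rho> k X) (\<rho> k Y) = \<rho> k (\<Lambda> X Y))"

definition metric_nomizu_map ::
  "('g \<Rightarrow> 'v \<Rightarrow> 'v) \<Rightarrow> 'g set \<Rightarrow> 'v::real_vector set \<Rightarrow> ('v \<Rightarrow> 'v \<Rightarrow> real) \<Rightarrow>
     ('v \<Rightarrow> 'v \<Rightarrow> 'v) \<Rightarrow> bool" where
  "metric_nomizu_map \<rho> K \<mm> g \<Lambda> \<longleftrightarrow>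
     nomizu_map \<rho> K \<mm> \<Lambda> \<and>
     (\<forall>X\<in>\<mm>. \<forall>Y\<in>\<mm>. \<forall>Z\<in>\<mm>. g (\<Lambda> X Y) Z + g Y (\<Lambda> X Z) = 0)"

definition nomizu_torsion ::
  "('v \<Rightarrow> 'v \<Rightarrow> 'v) \<Rightarrow> 'v set \<Rightarrow> 'v::real_vector set \<Rightarrow> ('v \<Rightarrow> 'v \<Rightarrow> 'v) \<Rightarrow> 'v \<Rightarrow> 'v \<Rightarrow> 'v" where
  "nomizu_torsion br \<kk> \<mm> \<Lambda> X Y = \<Lambda> X Y - \<Lambda> Y X - component \<mm> \<kk> (br X Y)"

definition levi_civita_nomizu_map ::
  "('g \<Rightarrow> 'v \<Rightarrow> 'v) \<Rightarrow> 'g set \<Rightarrow> ('v \<Rightarrow> 'v \<Rightarrow> 'v) \<Rightarrow> 'v set \<Rightarrow> 'v::real_vector set \<Rightarrow>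
     ('v \<Rightarrow> 'v \<Rightarrow> real) \<Rightarrow> ('v \<Rightarrow> 'v \<Rightarrow> 'v) \<Rightarrow> bool" where
  "levi_civita_nomizu_map \<rho> K br \<kk> \<mm> g \<Lambda> \<longleftrightarrow>
     metric_nomizu_map \<rho> K \<mm> g \<Lambda> \<and>
     (\<forall>X\<in>\<mm>. \<forall>Y\<in>\<mm>. nomizu_torsion br \<kk> \<mm> \<Lambda> X Y = 0)"

type_synonym 'v tensor3 = "'v \<Rightarrow> 'v \<Rightarrow> 'v \<Rightarrow> real"

definition orthonormal_frame ::
  "'v::real_vector set \<Rightarrow> ('v \<Rightarrow> 'v \<Rightarrow> real) \<Rightarrow> 'v set \<Rightarrow> bool" where
  "orthonormal_frame \<mm> g E \<longleftrightarrow>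
     finite E \<and> span E = \<mm> \<and> (\<forall>e\<in>E. \<forall>f\<in>E. g e f = (if e = f then 1 else 0))"

definition tensor_space :: "'v::real_vector set \<Rightarrow> 'v tensor3 set" where
  "tensor_space \<mm> =
     {A. (\<forall>Y\<in>\<mm>. \<forall>Z\<in>\<mm>. linear_on_set \<mm> (\<lambda>X. A X Y Z)) \<and>
         (\<forall>X\<in>\<mm>. \<forall>Z\<in>\<mm>. linear_on_set \<mm> (\<lambda>Y. A X Y Z)) \<and>
         (\<forall>X\<in>\<mm>. \<forall>Y\<in>\<mm>. linear_on_set \<mm> (\<lambda>Z. A X Y Z)) \<and>
         (\<forall>X\<in>\<mm>. \<forall>Y\<in>\<mm>. \<forall>Z\<in>\<mm>. A X Y Z + A X Z Y = 0)}"

definition type_A2 :: "'v::real_vector set \<Rightarrow> 'v tensor3 set" where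
  "type_A2 \<mm> = {A \<in> tensor_space \<mm>. \<forall>X\<in>\<mm>. \<forall>Y\<in>\<mm>. \<forall>Z\<in>\<mm>. A X Y Z + A Y X Z = 0}"

definition type_A3 :: "'v::real_vector set \<Rightarrow> ('v \<Rightarrow> 'v \<Rightarrow> real) \<Rightarrow> 'v tensor3 set" where
  "type_A3 \<mm> g = {A \<in> tensor_space \<mm>.
     (\<forall>X\<in>\<mm>. \<forall>Y\<in>\<mm>. \<forall>Z\<in>\<mm>. A X Y Z + A Y Z X + A Z X Y = 0) \<and>
     (\<forall>E. orthonormal_frame \<mm> g E \<longrightarrow> (\<forall>Z\<in>\<mm>. (\<Sum>e\<in>E. A e e Z) = 0))}"

definition tensor_sum :: "'v set \<Rightarrow> 'v tensor3 set \<Rightarrow> 'v tensor3 set \<Rightarrow> 'v tensor3 set" where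
  "tensor_sum \<mm> P Q =
     {A. \<exists>A'\<in>P. \<exists>A''\<in>Q. \<forall>X\<in>\<mm>. \<forall>Y\<in>\<mm>. \<forall>Z\<in>\<mm>. A X Y Z = A' X Y Z + A'' X Y Z}"

text \<open>The Levi-Civita map of a nondegenerate \<^term>\<open>g\<close> is unique on \<open>\<mm>\<close>, so that the existential
  quantifier only names it and asserts its existence.\<close>

definition torsion_of_type ::
  "('g \<Rightarrow> 'v \<Rightarrow> 'v) \<Rightarrow> 'g set \<Rightarrow> ('v \<Rightarrow> 'v \<Rightarrow> 'v) \<Rightarrow> 'v set \<Rightarrow> 'v::real_vector set \<Rightarrow>
     ('v \<Rightarrow> 'v \<Rightarrow> real) \<Rightarrow> 'v tensor3 set \<Rightarrow> ('v \<Rightarrow> 'v \<Rightarrow> 'v) \<Rightarrow> bool" where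
  "torsion_of_type \<rho> K br \<kk> \<mm> g P \<Lambda> \<longleftrightarrow>
     (\<exists>\<Lambda>g. levi_civita_nomizu_map \<rho> K br \<kk> \<mm> g \<Lambda>g \<and>
        (\<lambda>X Y Z. g (\<Lambda> X Y - \<Lambda>g X Y) Z) \<in> P)"

definition metric_t ::
  "('v \<Rightarrow> 'v \<Rightarrow> real) \<Rightarrow> 'v set \<Rightarrow> 'v::real_vector set \<Rightarrow> real \<Rightarrow> 'v \<Rightarrow> 'v \<Rightarrow> real" where
  "metric_t B \<mm>1 \<mm>2 t X Y =
     B (component \<mm>1 \<mm>2 X) (component \<mm>1 \<mm>2 Y) +
     2 * t * B (component \<mm>2 \<mm>1 X) (component \<mm>2 \<mm>1 Y)"

definition Lambda_t ::
  "('v \<Rightarrow> 'v \<Rightarrow> 'v) \<Rightarrow> 'v set \<Rightarrow> 'v set \<Rightarrow> 'v::real_vector set \<Rightarrow> real \<Rightarrow> 'v \<Rightarrow> 'v \<Rightarrow> 'v" where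
  "Lambda_t br \<kk> \<mm>1 \<mm>2 t X Y =
     (let X1 = component \<mm>1 \<mm>2 X; X2 = component \<mm>2 \<mm>1 X;
          Y1 = component \<mm>1 \<mm>2 Y; Y2 = component \<mm>2 \<mm>1 Y
      in (1/2) *\<^sub>R component \<mm>2 (\<kk> + \<mm>1) (br X1 Y1) + t *\<^sub>R br X1 Y2 + (1 - t) *\<^sub>R br X2 Y1)"

definition Lambda_st ::
  "('v \<Rightarrow> 'v \<Rightarrow> 'v) \<Rightarrow> 'v set \<Rightarrow> 'v set \<Rightarrow> 'v::real_vector set \<Rightarrow> real \<Rightarrow> real \<Rightarrow>
     'v \<Rightarrow> 'v \<Rightarrow> 'v" where
  "Lambda_st br \<kk> \<mm>1 \<mm>2 s t X Y = s *\<^sub>R Lambda_t br \<kk> \<mm>1 \<mm>2 t X Y"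

end

theory Submission
  imports Defs
begin

text \<open>For fixed \<open>t\<close> the Nomizu maps of the family are the multiples \<open>s \<Lambda>\<^sub>t\<close> of the Levi-Civita one, so
the difference from the Levi-Civita connection of \<open>g\<^sub>t\<close> is the tensor \<open>(s - 1) \<omega>\<^sub>t\<close> with
\<open>\<omega>\<^sub>t(X, Y, Z) = g\<^sub>t(\<Lambda>\<^sub>t(X)Y, Z)\<close>. Writing \<open>X = X\<^sub>1 + X\<^sub>2\<close>
along \<open>\<mm> = \<mm>\<^sub>1 \<oplus> \<mm>\<^sub>2\<close> and using that \<open>\<kk>\<close> is orthogonal to \<open>\<mm>\<close>, one finds
\<open>\<omega>\<^sub>t(X, Y, Z) = t (B([X\<^sub>1, Y\<^sub>2], Z\<^sub>1) + B([X\<^sub>1, Y\<^sub>1], Z\<^sub>2)) + (1 - t) B([X\<^sub>2, Y\<^sub>1], Z\<^sub>1)\<close>.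
Invariance of the Killing form under \<open>ad\<close> makes this skew in \<open>Y\<close> and \<open>Z\<close>, which is the metric
property; for \<open>t = 1/2\<close> the coefficients agree and the form is skew in \<open>X\<close> and \<open>Y\<close> as well.

A tensor that is skew in its last two arguments is its cyclic mean, which is totally skew, plus a
part with vanishing cyclic sum. Hence it lies in \<open>\<A>\<^sub>2 \<oplus> \<A>\<^sub>3\<close> as soon as its trace \<open>\<Phi>\<close>
vanishes. Here \<open>\<omega>\<^sub>t(X, X, Z) = (2t - 1) B(X\<^sub>1, [X\<^sub>2, Z\<^sub>1])\<close>, so up to a factor \<open>\<Phi>(\<omega>\<^sub>t)(Z)\<close> is
the trace of the endomorphism \<open>X \<mapsto> [X\<^sub>2, Z\<^sub>1]\<close> of \<open>\<mm>\<close>. It maps \<open>\<mm>\<^sub>2\<close> into \<open>\<mm>\<^sub>1\<close> and kills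
\<open>\<mm>\<^sub>1\<close>, so it has trace zero (\<open>orthonormal_frame_trace_offdiagonal\<close>).

What remains is Lie theory at the identity, developed from the coordinate definitions: the
bracket is bilinear, skew and satisfies the Jacobi identity (\<open>bracket_jacobi\<close>), and the adjoint
representation acts by automorphisms of it (\<open>adjoint_rep_bracket\<close>). The last two come from
differentiating the associative law, respectively the homomorphism law, twice and cancelling the
second derivatives by their symmetry (\<open>second_derivative_commute\<close>). The Killing form is therefore
invariant under \<open>ad\<close> and \<open>Ad\<close>. Equivariance of \<open>\<Lambda>\<^sub>t\<close> also needs that \<open>Ad(K)\<close> preserves \<open>\<kk>\<close>;
this follows from the invariance of \<open>\<mm>\<close>, because nondegeneracy of \<open>B\<close> forces \<open>\<kk>\<close> to be the
full orthogonal complement of \<open>\<mm>\<close>.\<close>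

section \<open>Iterated derivatives\<close>

lemma Ck_on_subset: "Ck_on k S f \<Longrightarrow> S' \<subseteq> S \<Longrightarrow> Ck_on k S' f"
  by (induction k arbitrary: f) (auto intro: continuous_on_subset)

lemma Ck_on_SucD: "Ck_on (Suc k) S f \<Longrightarrow> Ck_on k S f"
proof (induction k arbitrary: f)
  case 0
  then show ?case
    by (auto intro!: continuous_at_imp_continuous_on differentiable_imp_continuous_within)
next
  case (Suc k)
  then show ?case by (metis Ck_on.simps(2))
qed

text \<open>Both differentiability and the derivative at a point are local, so on an open set it does not
matter what the functions do elsewhere.\<close>

lemma Ck_on_cong:
  assumes "open S" "\<And>x. x \<in> S \<Longrightarrow> f x = g x" "Ck_on k S f"
  shows "Ck_on k S g"
  using assms(2,3)
proof (induction k arbitrary: f g)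
  case 0
  then show ?case by (simp cong: continuous_on_cong)
next
  case (Suc k)
  have df: "g differentiable (at x)" if "x \<in> S" for x
  proof -
    have "f differentiable (at x)" using Suc.prems that by simp
    then show ?thesis
      using that Suc.prems(1) assms(1) unfolding differentiable_def
      by (metis has_derivative_transform_within_open)
  qed
  have fd: "frechet_derivative f (at x) = frechet_derivative g (at x)" if "x \<in> S" for x
    using frechet_derivative_transform_within_open[of f x S g] Suc.prems assms(1) that by simp
  have "Ck_on k S (\<lambda>x. frechet_derivative g (at x) v)" for v
    by (rule Suc.IH[of "\<lambda>x. frechet_derivative f (at x) v"]) (use fd Suc.prems in auto)
  then show ?case using df by simp
qed

lemma Ck_on_SucI:
  assumes "open S" "\<And>x. x \<in> S \<Longrightarrow> (f has_derivative f' x) (at x)"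
    and "\<And>v. Ck_on k S (\<lambda>x. f' x v)"
  shows "Ck_on (Suc k) S f"
proof -
  have "frechet_derivative f (at x) = f' x" if "x \<in> S" for x
    using assms(2)[OF that] frechet_derivative_at by force
  then have "Ck_on k S (\<lambda>x. frechet_derivative f (at x) v)" for v
    using Ck_on_cong[OF assms(1) _ assms(3)[of v]] by simp
  then show ?thesis using assms(2) by (auto simp: differentiable_def)
qed

lemma Ck_on_has_derivative:
  "Ck_on (Suc k) S f \<Longrightarrow> x \<in> S \<Longrightarrow> (f has_derivative frechet_derivative f (at x)) (at x)"
  by (simp add: frechet_derivative_works[symmetric])

lemma Ck_on_const: "Ck_on k S (\<lambda>x. b)"
  by (induction k arbitrary: b) auto

lemma Ck_on_bounded_linear:
  assumes "bounded_linear f"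
  shows "Ck_on k S f"
proof (cases k)
  case 0
  then show ?thesis by (simp add: assms linear_continuous_on)
next
  case (Suc m)
  have der: "(f has_derivative f) (at x)" for x
    by (rule bounded_linear_imp_has_derivative[OF assms])
  then have "frechet_derivative f (at x) = f" for x
    by (rule frechet_derivative_at[symmetric])
  then show ?thesis
    using der by (auto simp: Suc differentiable_def Ck_on_const)
qed

lemma Ck_on_add:
  assumes "open S"
  shows "Ck_on k S f \<Longrightarrow> Ck_on k S g \<Longrightarrow> Ck_on k S (\<lambda>x. f x + g x)"
proof (induction k arbitrary: f g)
  case 0
  then show ?case by (auto intro: continuous_intros)
next
  case (Suc k)
  show ?case
    by (rule Ck_on_SucI[OF assms has_derivative_add
          [OF Ck_on_has_derivative[OF Suc.prems(1)] Ck_on_has_derivative[OF Suc.prems(2)]]])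
       (use Suc in auto)
qed

lemma Ck_on_sum:
  assumes "open S" "\<And>i. i \<in> I \<Longrightarrow> Ck_on k S (f i)"
  shows "Ck_on k S (\<lambda>x. \<Sum>i\<in>I. f i x)"
  using assms(2)
  by (induction I rule: infinite_finite_induct) (auto intro: Ck_on_const Ck_on_add[OF assms(1)])

lemma Ck_on_scaleR:
  assumes "open S"
  shows "Ck_on k S f \<Longrightarrow> Ck_on k S g \<Longrightarrow> Ck_on k S (\<lambda>x. f x *\<^sub>R g x)"
proof (induction k arbitrary: f g)
  case 0
  then show ?case by (auto intro: continuous_intros)
next
  case (Suc k)
  show ?case
    by (rule Ck_on_SucI[OF assms has_derivative_scaleR
          [OF Ck_on_has_derivative[OF Suc.prems(1)] Ck_on_has_derivative[OF Suc.prems(2)]]])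
       (use Suc.prems in \<open>auto intro!: Ck_on_add[OF assms] Suc.IH Ck_on_SucD[OF Suc.prems(1)]
          Ck_on_SucD[OF Suc.prems(2)]\<close>)
qed

lemma Ck_on_bounded_linear_comp:
  assumes "open S" "bounded_linear L"
  shows "Ck_on k S f \<Longrightarrow> Ck_on k S (\<lambda>x. L (f x))"
proof (induction k arbitrary: f)
  case 0
  then show ?case
    using linear_continuous_on[OF assms(2)] by (auto intro: continuous_on_compose2)
next
  case (Suc k)
  show ?case
    by (rule Ck_on_SucI[OF assms(1) bounded_linear.has_derivative[OF assms(2)
          Ck_on_has_derivative[OF Suc.prems]]]) (use Suc in auto)
qed

text \<open>Expanding the inner derivative in a basis turns the chain rule into a finite sum of products, to
which the induction hypothesis and the closure under sums and products apply.\<close>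

lemma Ck_on_compose:
  fixes f :: "'a::real_normed_vector \<Rightarrow> 'b::euclidean_space" and g :: "'b \<Rightarrow> 'c::real_normed_vector"
  assumes "open S"
  shows "f ` S \<subseteq> S' \<Longrightarrow> Ck_on k S f \<Longrightarrow> Ck_on k S' g \<Longrightarrow> Ck_on k S (\<lambda>x. g (f x))"
proof (induction k arbitrary: f g)
  case 0
  then show ?case
    by (auto intro: continuous_on_compose2)
next
  case (Suc k)
  let ?f' = "\<lambda>x. frechet_derivative f (at x)" and ?g' = "\<lambda>y. frechet_derivative g (at y)"
  have der: "((\<lambda>x. g (f x)) has_derivative (\<lambda>v. \<Sum>b\<in>Basis. (?f' x v \<bullet> b) *\<^sub>R ?g' (f x) b)) (at x)"
    if "x \<in> S" for x
  proof -
    have f': "(f has_derivative ?f' x) (at x)"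
      by (rule Ck_on_has_derivative[OF Suc.prems(2) that])
    have g': "(g has_derivative ?g' (f x)) (at (f x))"
      by (rule Ck_on_has_derivative[OF Suc.prems(3)]) (use that Suc.prems(1) in auto)
    have lin: "linear (?g' (f x))"
      using g' has_derivative_linear by blast
    have "?g' (f x) u = (\<Sum>b\<in>Basis. (u \<bullet> b) *\<^sub>R ?g' (f x) b)" for u
    proof -
      have "?g' (f x) u = ?g' (f x) (\<Sum>b\<in>Basis. (u \<bullet> b) *\<^sub>R b)"
        by (simp add: euclidean_representation)
      then show ?thesis
        by (simp add: linear_sum[OF lin] linear_scale[OF lin])
    qed
    then have "(\<lambda>v. ?g' (f x) (?f' x v)) = (\<lambda>v. \<Sum>b\<in>Basis. (?f' x v \<bullet> b) *\<^sub>R ?g' (f x) b)"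
      by (intro ext)
    with has_derivative_compose[OF f' g'] show ?thesis
      by (rule back_subst)
  qed
  have ck: "Ck_on k S (\<lambda>x. \<Sum>b\<in>Basis. (?f' x v \<bullet> b) *\<^sub>R ?g' (f x) b)" for v
  proof (intro Ck_on_sum[OF assms(1)] Ck_on_scaleR[OF assms(1)])
    fix b :: 'b
    show "Ck_on k S (\<lambda>x. ?f' x v \<bullet> b)"
      by (rule Ck_on_bounded_linear_comp[OF assms(1) bounded_linear_inner_left])
         (use Suc.prems(2) in simp)
    show "Ck_on k S (\<lambda>x. ?g' (f x) b)"
      by (rule Suc.IH[OF Suc.prems(1) Ck_on_SucD[OF Suc.prems(2)], where g = "\<lambda>y. ?g' y b"])
         (use Suc.prems(3) in simp)
  qed
  show ?case
    by (rule Ck_on_SucI[OF assms(1) der ck])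
qed

lemma has_real_derivative_along_line:
  fixes f :: "'a::real_normed_vector \<Rightarrow> real"
  assumes "(f has_derivative f') (at (p + \<tau> *\<^sub>R v))"
  shows "((\<lambda>\<tau>. f (p + \<tau> *\<^sub>R v)) has_real_derivative f' v) (at \<tau>)"
proof -
  have "((\<lambda>\<tau>. p + \<tau> *\<^sub>R v) has_derivative (\<lambda>r. r *\<^sub>R v)) (at \<tau>)"
    by (auto intro!: derivative_eq_intros)
  from has_derivative_compose[OF this assms]
  have "((\<lambda>\<tau>. f (p + \<tau> *\<^sub>R v)) has_derivative (\<lambda>r. f' (r *\<^sub>R v))) (at \<tau>)" .
  moreover have "f' (r *\<^sub>R v) = f' v * r" for r
    using linear_scale[OF has_derivative_linear[OF assms]] by (simp add: mult.commute)
  ultimately show ?thesis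
    by (simp add: has_field_derivative_def)
qed

text \<open>The mean value theorem is applied first in the direction \<^term>\<open>v\<close>, to the increment of
\<^term>\<open>f\<close> by \<^term>\<open>h *\<^sub>R w\<close>, and then in the direction \<^term>\<open>w\<close>. The second difference on the
left is symmetric in \<^term>\<open>v\<close> and \<^term>\<open>w\<close>, the right-hand side not visibly so.\<close>

lemma second_difference_mean_value:
  fixes f :: "'a::real_normed_vector \<Rightarrow> real"
  assumes ck: "Ck_on 2 (ball x \<delta>) f" and h: "h > 0" "h * (norm v + norm w) < \<delta>"
  shows "\<exists>p. dist x p \<le> h * (norm v + norm w) \<and>
    f (x + h *\<^sub>R v + h *\<^sub>R w) - f (x + h *\<^sub>R v) - f (x + h *\<^sub>R w) + f x
      = h\<^sup>2 * frechet_derivative (\<lambda>y. frechet_derivative f (at y) v) (at p) w"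
proof -
  let ?f' = "\<lambda>y. frechet_derivative f (at y)"
  let ?f'' = "\<lambda>y. frechet_derivative (\<lambda>y. frechet_derivative f (at y) v) (at y)"
  have ck: "Ck_on (Suc (Suc 0)) (ball x \<delta>) f"
    using ck by (simp add: numeral_2_eq_2)
  have d: "dist x (x + a *\<^sub>R v + b *\<^sub>R w) \<le> h * (norm v + norm w)"
    if "0 \<le> a" "a \<le> h" "0 \<le> b" "b \<le> h" for a b
  proof -
    have "dist x (x + a *\<^sub>R v + b *\<^sub>R w) \<le> norm (a *\<^sub>R v) + norm (b *\<^sub>R w)"
      by (metis add.assoc dist_add_cancel dist_0_norm norm_triangle_ineq add.right_neutral)
    also have "\<dots> \<le> h * norm v + h * norm w"
      using that by (intro add_mono) (auto intro: mult_right_mono)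
    finally show ?thesis by (simp add: algebra_simps)
  qed
  have in_ball: "x + a *\<^sub>R v + b *\<^sub>R w \<in> ball x \<delta>"
    if "0 \<le> a" "a \<le> h" "0 \<le> b" "b \<le> h" for a b
    using d[OF that] h by simp
  have d1: "((\<lambda>a. f (x + a *\<^sub>R v + b *\<^sub>R w)) has_real_derivative
      ?f' (x + a *\<^sub>R v + b *\<^sub>R w) v) (at a)"
    if "0 \<le> a" "a \<le> h" "0 \<le> b" "b \<le> h" for a b
    using has_real_derivative_along_line[of f "?f' (x + a *\<^sub>R v + b *\<^sub>R w)" "x + b *\<^sub>R w" a v]
      Ck_on_has_derivative[OF ck in_ball[OF that]] by (simp add: algebra_simps)
  have d2: "((\<lambda>b. ?f' (x + a *\<^sub>R v + b *\<^sub>R w) v) has_real_derivative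
      ?f'' (x + a *\<^sub>R v + b *\<^sub>R w) w) (at b)"
    if "0 \<le> a" "a \<le> h" "0 \<le> b" "b \<le> h" for a b
  proof (rule has_real_derivative_along_line
        [of "\<lambda>y. ?f' y v" "?f'' (x + a *\<^sub>R v + b *\<^sub>R w)"])
    have "Ck_on (Suc 0) (ball x \<delta>) (\<lambda>y. ?f' y v)"
      using ck by simp
    then show "((\<lambda>y. ?f' y v) has_derivative ?f'' (x + a *\<^sub>R v + b *\<^sub>R w))
        (at (x + a *\<^sub>R v + b *\<^sub>R w))"
      by (rule Ck_on_has_derivative[OF _ in_ball[OF that]])
  qed
  have "\<exists>a>0. a < h \<and>
     (f (x + h *\<^sub>R v + h *\<^sub>R w) - f (x + h *\<^sub>R v + 0 *\<^sub>R w)) -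
     (f (x + 0 *\<^sub>R v + h *\<^sub>R w) - f (x + 0 *\<^sub>R v + 0 *\<^sub>R w))
     = (h - 0) * (?f' (x + a *\<^sub>R v + h *\<^sub>R w) v - ?f' (x + a *\<^sub>R v + 0 *\<^sub>R w) v)"
    using h(1)
    by (intro MVT2 derivative_intros d1) auto
  then obtain a where a: "a > 0" "a < h"
    and eq1: "f (x + h *\<^sub>R v + h *\<^sub>R w) - f (x + h *\<^sub>R v) - f (x + h *\<^sub>R w) + f x
     = h * (?f' (x + a *\<^sub>R v + h *\<^sub>R w) v - ?f' (x + a *\<^sub>R v + 0 *\<^sub>R w) v)"
    by (auto simp: algebra_simps)
  have "\<exists>b>0. b < h \<and> ?f' (x + a *\<^sub>R v + h *\<^sub>R w) v - ?f' (x + a *\<^sub>R v + 0 *\<^sub>R w) v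
     = (h - 0) * ?f'' (x + a *\<^sub>R v + b *\<^sub>R w) w"
    by (rule MVT2[of 0 h "\<lambda>b. ?f' (x + a *\<^sub>R v + b *\<^sub>R w) v"
          "\<lambda>b. ?f'' (x + a *\<^sub>R v + b *\<^sub>R w) w"])
      (use h(1) a in \<open>auto intro: d2\<close>)
  then obtain b where b: "b > 0" "b < h"
    and eq2: "?f' (x + a *\<^sub>R v + h *\<^sub>R w) v - ?f' (x + a *\<^sub>R v + 0 *\<^sub>R w) v
      = h * ?f'' (x + a *\<^sub>R v + b *\<^sub>R w) w"
    by auto
  show ?thesis
    by (rule exI[of _ "x + a *\<^sub>R v + b *\<^sub>R w"])
       (use a b d eq1 eq2 in \<open>auto simp: power2_eq_square\<close>)
qed

text \<open>By \<open>second_difference_mean_value\<close> the two mixed derivatives agree at some pair of points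
arbitrarily close to \<^term>\<open>x\<close>; both are continuous at \<^term>\<open>x\<close>.\<close>

lemma second_derivative_commute_real:
  fixes f :: "'a::real_normed_vector \<Rightarrow> real"
  assumes S: "open S" "x \<in> S" and ck: "Ck_on 2 S f"
  shows "frechet_derivative (\<lambda>y. frechet_derivative f (at y) v) (at x) w
       = frechet_derivative (\<lambda>y. frechet_derivative f (at y) w) (at x) v"
proof -
  define D where "D = (\<lambda>v w y. frechet_derivative (\<lambda>y. frechet_derivative f (at y) v) (at y) w)"
  obtain \<delta> where \<delta>: "\<delta> > 0" "ball x \<delta> \<subseteq> S"
    using S open_contains_ball by blast
  have cont: "continuous_on S (D v w)" for v w
    using ck by (simp add: numeral_2_eq_2 D_def)
  have close: "\<exists>r>0. \<forall>y. dist x y < r \<longrightarrow> \<bar>D v w y - D v w x\<bar> < \<epsilon>" if "\<epsilon> > 0" for v w \<epsilon>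
  proof -
    have "isCont (D v w) x"
      using cont S by (simp add: continuous_on_eq_continuous_at)
    then show ?thesis
      unfolding continuous_at_eps_delta dist_real_def using that by (metis dist_commute)
  qed
  have "\<bar>D v w x - D w v x\<bar> \<le> \<epsilon>" if \<epsilon>: "\<epsilon> > 0" for \<epsilon>
  proof -
    obtain r where r: "r > 0" "\<And>y. dist x y < r \<Longrightarrow> \<bar>D v w y - D v w x\<bar> < \<epsilon>/2"
      using close[OF half_gt_zero[OF \<epsilon>], of v w] by metis
    obtain r' where r': "r' > 0" "\<And>y. dist x y < r' \<Longrightarrow> \<bar>D w v y - D w v x\<bar> < \<epsilon>/2"
      using close[OF half_gt_zero[OF \<epsilon>], of w v] by metis
    define m where "m = min \<delta> (min r r')"
    define N where "N = norm v + norm w"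
    (* Half of the available radius, so that the bound is strict; the 1 avoids dividing by zero. *)
    define h where "h = m / 2 / (N + 1)"
    have N: "N + 1 > 0"
      using norm_ge_zero[of v] norm_ge_zero[of w] unfolding N_def by linarith
    have m: "m > 0" "m \<le> \<delta>" "m \<le> r" "m \<le> r'"
      using \<delta> r r' by (auto simp: m_def)
    have h: "h > 0"
      using N m by (simp add: h_def)
    have "h * (N + 1) = m / 2"
      by (rule iffD1[OF nonzero_eq_divide_eq[OF less_imp_neq[OF N, symmetric]] h_def])
    then have "h * N + h = m / 2"
      by (simp add: distrib_left)
    then have "h * N < m"
      using h m(1) by linarith
    then have small: "h * (norm v + norm w) < \<delta>" "h * (norm v + norm w) < r"
      "h * (norm v + norm w) < r'"
      using m unfolding N_def by linarith+
    have ck': "Ck_on 2 (ball x \<delta>) f" using ck \<delta>(2) by (rule Ck_on_subset)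
    obtain p where p: "dist x p \<le> h * (norm v + norm w)"
      "f (x + h *\<^sub>R v + h *\<^sub>R w) - f (x + h *\<^sub>R v) - f (x + h *\<^sub>R w) + f x = h\<^sup>2 * D v w p"
      using second_difference_mean_value[OF ck' h, of v w] small by (auto simp: D_def)
    obtain q where q: "dist x q \<le> h * (norm v + norm w)"
      "f (x + h *\<^sub>R w + h *\<^sub>R v) - f (x + h *\<^sub>R w) - f (x + h *\<^sub>R v) + f x = h\<^sup>2 * D w v q"
      using second_difference_mean_value[OF ck' h, of w v] small 
      by (auto simp: D_def algebra_simps)
    have "h\<^sup>2 * D v w p = h\<^sup>2 * D w v q"
      using p(2) q(2) by (simp add: algebra_simps)
    then have "D v w p = D w v q" using h by simp
    moreover have "\<bar>D v w p - D v w x\<bar> < \<epsilon>/2" using r(2)[of p] p(1) small by linarith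
    moreover have "\<bar>D w v q - D w v x\<bar> < \<epsilon>/2" using r'(2)[of q] q(1) small by linarith
    ultimately show ?thesis by linarith
  qed
  then have "\<bar>D v w x - D w v x\<bar> \<le> 0"
    by (rule field_le_epsilon) simp
  then show ?thesis by (simp add: D_def)
qed

lemma second_derivative_commute:
  fixes f :: "'a::real_normed_vector \<Rightarrow> 'b::euclidean_space"
  assumes S: "open S" "x \<in> S" and ck: "Ck_on 2 S f"
  shows "frechet_derivative (\<lambda>y. frechet_derivative f (at y) v) (at x) w
       = frechet_derivative (\<lambda>y. frechet_derivative f (at y) w) (at x) v"
proof (rule euclidean_eqI)
  fix b :: 'b assume "b \<in> Basis"
  have ck2: "Ck_on (Suc (Suc 0)) S f" using ck by (simp add: numeral_2_eq_2)
  have inner: "frechet_derivative (\<lambda>y. g y \<bullet> b) (at y) u = frechet_derivative g (at y) u \<bullet> b"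
    if "g differentiable (at y)" for g :: "'a \<Rightarrow> 'b" and y u
    by (simp add: frechet_derivative_at[OF has_derivative_inner_left
          [OF frechet_derivative_works[THEN iffD1, OF that]], THEN sym])
  have *: "frechet_derivative (\<lambda>y. frechet_derivative (\<lambda>y. f y \<bullet> b) (at y) u) (at x) u'
    = frechet_derivative (\<lambda>y. frechet_derivative f (at y) u) (at x) u' \<bullet> b" for u u'
  proof -
    have "(\<lambda>y. frechet_derivative f (at y) u) differentiable (at x)"
      using ck2 S by simp
    from has_derivative_inner_left[OF frechet_derivative_works[THEN iffD1, OF this], of b]
    have "((\<lambda>y. frechet_derivative (\<lambda>y. f y \<bullet> b) (at y) u) has_derivative 
       (\<lambda>u'. frechet_derivative (\<lambda>y. frechet_derivative f (at y) u) (at x) u' \<bullet> b)) (at x)"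
      by (rule has_derivative_transform_within_open[OF _ S]) (use ck2 in \<open>simp add: inner\<close>)
    from frechet_derivative_at[OF this] show ?thesis by metis
  qed
  have "Ck_on 2 S (\<lambda>y. f y \<bullet> b)"
    by (rule Ck_on_bounded_linear_comp[OF S(1) bounded_linear_inner_left ck])
  from second_derivative_commute_real[OF S this]
  show "frechet_derivative (\<lambda>y. frechet_derivative f (at y) v) (at x) w \<bullet> b
       = frechet_derivative (\<lambda>y. frechet_derivative f (at y) w) (at x) v \<bullet> b"
    by (simp add: *)
qed

lemma smooth_on_derivative:
  "smooth_on S f \<Longrightarrow> smooth_on S (\<lambda>x. frechet_derivative f (at x) v)"
  unfolding smooth_on_def by (metis Ck_on.simps(2))

lemma smooth_on_has_derivative:
  "smooth_on S f \<Longrightarrow> x \<in> S \<Longrightarrow> (f has_derivative frechet_derivative f (at x)) (at x)"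
  unfolding smooth_on_def using Ck_on_has_derivative by blast

lemma smooth_on_compose:
  fixes f :: "'a::real_normed_vector \<Rightarrow> 'b::euclidean_space" and g :: "'b \<Rightarrow> 'c::real_normed_vector"
  assumes "open S" "f ` S \<subseteq> S'" "smooth_on S f" "smooth_on S' g"
  shows "smooth_on S (\<lambda>x. g (f x))"
  using assms Ck_on_compose unfolding smooth_on_def by blast

lemma smooth_on_subset: "smooth_on S f \<Longrightarrow> S' \<subseteq> S \<Longrightarrow> smooth_on S' f"
  unfolding smooth_on_def using Ck_on_subset by blast

lemma smooth_on_cong:
  "open S \<Longrightarrow> (\<And>x. x \<in> S \<Longrightarrow> f x = g x) \<Longrightarrow> smooth_on S f \<Longrightarrow> smooth_on S g"
  unfolding smooth_on_def using Ck_on_cong by blast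

lemma smooth_on_affine:
  assumes "open S" "bounded_linear L"
  shows "smooth_on S (\<lambda>x. b + L x)"
  unfolding smooth_on_def
  using Ck_on_add[OF assms(1) Ck_on_const Ck_on_bounded_linear[OF assms(2)]] by blast

lemma smooth_on_second_derivative_commute:
  fixes f :: "'a::real_normed_vector \<Rightarrow> 'b::euclidean_space"
  assumes "open S" "smooth_on S f" "x \<in> S"
  shows "frechet_derivative (\<lambda>y. frechet_derivative f (at y) v) (at x) w
       = frechet_derivative (\<lambda>y. frechet_derivative f (at y) w) (at x) v"
  using second_derivative_commute assms unfolding smooth_on_def by blast

text \<open>The product rule for applying a point-dependent linear map to a point-dependent vector.
Differentiability of the family is asked vector by vector, which is what iterated directional
derivatives provide; in finite dimension a basis expansion reduces this to products with scalars.\<close>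

lemma has_derivative_apply_linear:
  fixes D :: "'a::real_normed_vector \<Rightarrow> 'b::euclidean_space \<Rightarrow> 'c::real_normed_vector"
  assumes U: "open U" "x \<in> U" and lin: "\<And>y. y \<in> U \<Longrightarrow> linear (D y)"
    and D': "\<And>v. ((\<lambda>y. D y v) has_derivative D' v) (at x)"
    and u': "(u has_derivative u') (at x)"
  shows "((\<lambda>y. D y (u y)) has_derivative (\<lambda>h. D' (u x) h + D x (u' h))) (at x)"
proof -
  have expand: "D y v = (\<Sum>b\<in>Basis. (v \<bullet> b) *\<^sub>R D y b)" if "y \<in> U" for y v
  proof -
    have "D y v = D y (\<Sum>b\<in>Basis. (v \<bullet> b) *\<^sub>R b)"
      by (simp add: euclidean_representation)
    then show ?thesis
      by (simp add: linear_sum[OF lin[OF that]] linear_scale[OF lin[OF that]])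
  qed
  have "((\<lambda>y. \<Sum>b\<in>Basis. (v \<bullet> b) *\<^sub>R D y b) has_derivative
      (\<lambda>h. \<Sum>b\<in>Basis. (v \<bullet> b) *\<^sub>R D' b h)) (at x)"
    for v by (intro has_derivative_sum has_derivative_scaleR_right D')
  then have "((\<lambda>y. D y v) has_derivative (\<lambda>h. \<Sum>b\<in>Basis. (v \<bullet> b) *\<^sub>R D' b h)) (at x)" for v
    by (rule has_derivative_transform_within_open[OF _ U]) (rule expand[symmetric])
  from has_derivative_unique[OF D' this]
  have D'_expand: "D' v h = (\<Sum>b\<in>Basis. (v \<bullet> b) *\<^sub>R D' b h)" for v h
    by (rule fun_cong)
  have "((\<lambda>y. \<Sum>b\<in>Basis. (u y \<bullet> b) *\<^sub>R D y b) has_derivative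
     (\<lambda>h. \<Sum>b\<in>Basis. (u x \<bullet> b) *\<^sub>R D' b h + (u' h \<bullet> b) *\<^sub>R D x b)) (at x)"
    by (intro has_derivative_sum has_derivative_scaleR has_derivative_inner_left D' u')
  moreover have "(\<Sum>b\<in>Basis. (u x \<bullet> b) *\<^sub>R D' b h + (u' h \<bullet> b) *\<^sub>R D x b)
      = D' (u x) h + D x (u' h)" for h
    unfolding sum.distrib D'_expand[of "u x" h, symmetric] expand[OF U(2), of "u' h", symmetric] ..
  ultimately have "((\<lambda>y. \<Sum>b\<in>Basis. (u y \<bullet> b) *\<^sub>R D y b) has_derivative
      (\<lambda>h. D' (u x) h + D x (u' h))) (at x)"
    by simp
  then show ?thesis
    by (rule has_derivative_transform_within_open[OF _ U]) (rule expand[symmetric])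
qed

section \<open>Local group laws\<close>

lemma has_derivative_transform_nhds:
  assumes "(f has_derivative f') (at x)" "\<forall>\<^sub>F y in nhds x. f y = g y"
  shows "(g has_derivative f') (at x)"
proof -
  obtain S where "open S" "x \<in> S" "\<forall>y\<in>S. f y = g y"
    using assms(2) unfolding eventually_nhds by blast
  then show ?thesis
    using has_derivative_transform_within_open[OF assms(1), of S g] by blast
qed

text \<open>A group law in the coordinates of one chart around the unit: \<open>V\<close> is the coordinate domain and
\<open>\<Omega>\<close> the set of pairs whose product stays in the chart. Associativity is required only for a
third factor near the unit, with a neighbourhood depending on the first two; derivatives at the
unit do not see more.\<close>

locale local_group_law =
  fixes V :: "'v::euclidean_space set" and \<Omega> :: "('v \<times> 'v) set" and \<mu> :: "'v \<Rightarrow> 'v \<Rightarrow> 'v" and e :: 'v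
  assumes open_V: "open V" and open_\<Omega>: "open \<Omega>" and e_in_V: "e \<in> V"
    and smooth_\<mu>: "smooth_on \<Omega> (\<lambda>(x, y). \<mu> x y)"
    and \<Omega>_right: "x \<in> V \<Longrightarrow> (x, e) \<in> \<Omega>"
    and right_unit: "x \<in> V \<Longrightarrow> \<mu> x e = x" and left_unit: "x \<in> V \<Longrightarrow> \<mu> e x = x"
    and \<mu>_in_V: "(x, y) \<in> \<Omega> \<Longrightarrow> \<mu> x y \<in> V" and \<Omega>_V: "(x, y) \<in> \<Omega> \<Longrightarrow> y \<in> V"
    and assoc: "(x, y) \<in> \<Omega> \<Longrightarrow> \<forall>\<^sub>F z in nhds e. \<mu> (\<mu> x y) z = \<mu> x (\<mu> y z)"
begin

text \<open>The left-invariant vector field with value \<open>X\<close> at the unit; \<open>bracket\<close> is the commutator of two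
such fields at the unit.\<close>

definition inv_field :: "'v \<Rightarrow> 'v \<Rightarrow> 'v" where
  "inv_field X y = frechet_derivative (\<mu> y) (at e) X"

definition bracket :: "'v \<Rightarrow> 'v \<Rightarrow> 'v" where
  "bracket X Y = frechet_derivative (inv_field Y) (at e) X - frechet_derivative (inv_field X) (at e) Y"

lemma \<mu>_has_derivative:
  assumes "(x, y) \<in> \<Omega>"
  shows "((\<lambda>(x, y). \<mu> x y) has_derivative frechet_derivative (\<lambda>(x, y). \<mu> x y) (at (x, y))) (at (x, y))"
  by (rule smooth_on_has_derivative[OF smooth_\<mu> assms])

lemma slice_has_derivative:
  assumes "(x, y) \<in> \<Omega>"
  shows "(\<mu> x has_derivative (\<lambda>v. frechet_derivative (\<lambda>(x, y). \<mu> x y) (at (x, y)) (0, v))) (at y)"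
proof -
  have "((\<lambda>y. (x, y)) has_derivative (\<lambda>v. (0, v))) (at y)"
    by (auto intro!: derivative_eq_intros)
  from has_derivative_compose[OF this \<mu>_has_derivative[OF assms]] show ?thesis
    by (simp add: eta_contract_eq)
qed

lemma slice_deriv:
  assumes "(x, y) \<in> \<Omega>"
  shows "frechet_derivative (\<mu> x) (at y) v = frechet_derivative (\<lambda>(x, y). \<mu> x y) (at (x, y)) (0, v)"
  by (simp add: frechet_derivative_at[OF slice_has_derivative[OF assms], THEN sym])

lemma slice_differentiable:
  assumes "(x, y) \<in> \<Omega>"
  shows "(\<mu> x has_derivative frechet_derivative (\<mu> x) (at y)) (at y)"
  using slice_has_derivative[OF assms] frechet_derivative_works[of "\<mu> x" "at y"]
  by (auto simp: differentiable_def)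

lemma linear_inv_field: "y \<in> V \<Longrightarrow> linear (\<lambda>X. inv_field X y)"
  unfolding inv_field_def using slice_differentiable[OF \<Omega>_right] has_derivative_linear by blast

lemma inv_field_at_unit: "inv_field X e = X"
proof -
  have "(\<mu> e has_derivative (\<lambda>v. v)) (at e)"
    by (rule has_derivative_transform_within_open[OF has_derivative_ident open_V e_in_V])
       (simp add: left_unit)
  from frechet_derivative_at[OF this] show ?thesis by (simp add: inv_field_def fun_eq_iff)
qed

lemma smooth_inv_field: "smooth_on V (inv_field X)"
proof -
  have "smooth_on V (\<lambda>y. frechet_derivative (\<lambda>(x, y). \<mu> x y) (at ((0, e) + (y, 0))) (0, X))"
    by (rule smooth_on_compose[OF open_V _ smooth_on_affine[OF open_V]
          smooth_on_derivative[OF smooth_\<mu>]])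
       (auto intro!: \<Omega>_right bounded_linear_intros)
  then show ?thesis
    by (rule smooth_on_cong[OF open_V, rotated]) (simp add: inv_field_def slice_deriv[OF \<Omega>_right])
qed

lemma smooth_slice:
  assumes "a \<in> V"
  obtains U where "open U" "e \<in> U" "smooth_on U (\<mu> a)" "\<And>x. x \<in> U \<Longrightarrow> (a, x) \<in> \<Omega>"
proof -
  define U where "U = (\<lambda>x. (a, x)) -` \<Omega>"
  have "open U"
    unfolding U_def by (rule open_vimage[OF open_\<Omega>]) (intro continuous_intros)
  moreover have "smooth_on U (\<lambda>x. (\<lambda>(x, y). \<mu> x y) ((a, 0) + (0, x)))"
    by (rule smooth_on_compose[OF \<open>open U\<close> _ smooth_on_affine[OF \<open>open U\<close>] smooth_\<mu>])
       (auto simp: U_def intro!: bounded_linear_intros)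
  ultimately show ?thesis
    using that[of U] assms \<Omega>_right by (simp add: U_def eta_contract_eq)
qed

text \<open>Differentiating the associative law \<open>\<mu> (\<mu> a x) z = \<mu> a (\<mu> x z)\<close> in \<open>z\<close> at the unit.\<close>

lemma inv_field_left_invariant:
  assumes "(a, x) \<in> \<Omega>"
  shows "inv_field Y (\<mu> a x) = frechet_derivative (\<mu> a) (at x) (inv_field Y x)"
proof -
  have xV: "x \<in> V" and aV: "\<mu> a x \<in> V" using assms \<Omega>_V \<mu>_in_V by auto
  have "(\<mu> a has_derivative frechet_derivative (\<mu> a) (at x)) (at (\<mu> x e))"
    using slice_differentiable[OF assms] right_unit[OF xV] by simp
  from has_derivative_compose[OF slice_differentiable[OF \<Omega>_right[OF xV]] this]
  have "((\<lambda>z. \<mu> a (\<mu> x z)) has_derivative (\<lambda>v. frechet_derivative (\<mu> a) (at x) (inv_field v x))) (at e)"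
    by (simp add: inv_field_def)
  moreover have "\<forall>\<^sub>F z in nhds e. \<mu> a (\<mu> x z) = \<mu> (\<mu> a x) z"
    using assoc[OF assms] by (rule eventually_mono) simp
  ultimately have "(\<mu> (\<mu> a x) has_derivative (\<lambda>v. frechet_derivative (\<mu> a) (at x) (inv_field v x))) (at e)"
    by (rule has_derivative_transform_nhds)
  from frechet_derivative_at[OF this] show ?thesis
    by (simp add: inv_field_def fun_eq_iff)
qed

abbreviation Dfield :: "'v \<Rightarrow> 'v \<Rightarrow> 'v \<Rightarrow> 'v" where
  "Dfield Y y \<equiv> frechet_derivative (inv_field Y) (at y)"

lemma inv_field_has_derivative: "y \<in> V \<Longrightarrow> (inv_field Y has_derivative Dfield Y y) (at y)"
  by (rule smooth_on_has_derivative[OF smooth_inv_field])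

text \<open>Differentiating \<open>inv_field_left_invariant\<close> in \<open>x\<close> at the unit. The first summand is a second
derivative of a left translation, hence symmetric in \<^term>\<open>X\<close> and \<^term>\<open>Y\<close>, and drops out of
commutators.\<close>

lemma Dfield_along_inv_field:
  assumes "a \<in> V"
  shows "Dfield Y a (inv_field X a)
     = frechet_derivative (\<lambda>x. frechet_derivative (\<mu> a) (at x) Y) (at e) X + inv_field (Dfield Y e X) a"
proof -
  obtain U where U: "open U" "e \<in> U" "smooth_on U (\<mu> a)" "\<And>x. x \<in> U \<Longrightarrow> (a, x) \<in> \<Omega>"
    using smooth_slice[OF assms] by blast
  let ?D = "\<lambda>x. frechet_derivative (\<mu> a) (at x)"
  have lhs: "((\<lambda>x. inv_field Y (\<mu> a x)) has_derivative (\<lambda>X. Dfield Y a (inv_field X a))) (at e)"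
    using has_derivative_compose[OF slice_differentiable[OF U(4)[OF U(2)]], of "inv_field Y" "Dfield Y a"]
      inv_field_has_derivative[OF assms] right_unit[OF assms] by (simp add: inv_field_def)
  have "((\<lambda>x. ?D x (inv_field Y x)) has_derivative
      (\<lambda>X. frechet_derivative (\<lambda>x. ?D x Y) (at e) X + inv_field (Dfield Y e X) a)) (at e)"
  proof -
    have "((\<lambda>x. ?D x (inv_field Y x)) has_derivative
      (\<lambda>X. frechet_derivative (\<lambda>x. ?D x (inv_field Y e)) (at e) X + ?D e (Dfield Y e X))) (at e)"
    proof (rule has_derivative_apply_linear[OF U(1,2), where D = ?D and
          D' = "\<lambda>v. frechet_derivative (\<lambda>x. ?D x v) (at e)" and u = "inv_field Y" and u' = "Dfield Y e"])
      show "linear (?D y)" if "y \<in> U" for y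
        using has_derivative_linear[OF slice_differentiable[OF U(4)[OF that]]] .
      show "((\<lambda>x. ?D x v) has_derivative frechet_derivative (\<lambda>x. ?D x v) (at e)) (at e)" for v
        by (rule smooth_on_has_derivative[OF smooth_on_derivative[OF U(3)] U(2)])
    qed (rule inv_field_has_derivative[OF e_in_V])
    then show ?thesis
      unfolding inv_field_at_unit inv_field_def[of "Dfield Y e _"] .
  qed
  then have "((\<lambda>x. inv_field Y (\<mu> a x)) has_derivative
      (\<lambda>X. frechet_derivative (\<lambda>x. ?D x Y) (at e) X + inv_field (Dfield Y e X) a)) (at e)"
    by (rule has_derivative_transform_within_open[OF _ U(1,2)]) (simp add: inv_field_left_invariant U(4))
  from has_derivative_unique[OF lhs this] show ?thesis
    by (rule fun_cong)
qed

lemma linear_Dfield: "y \<in> V \<Longrightarrow> linear (Dfield Y y)"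
  using inv_field_has_derivative has_derivative_linear by blast

lemma Dfield_add:
  assumes "y \<in> V" shows "Dfield (X + Y) y v = Dfield X y v + Dfield Y y v"
proof -
  have "(inv_field (X + Y) has_derivative (\<lambda>v. Dfield X y v + Dfield Y y v)) (at y)"
    by (rule has_derivative_transform_within_open[OF has_derivative_add[OF
          inv_field_has_derivative[OF assms, of X] inv_field_has_derivative[OF assms, of Y]] open_V assms])
       (simp add: linear_add[OF linear_inv_field])
  from frechet_derivative_at[OF this] show ?thesis by (simp add: fun_eq_iff)
qed

lemma Dfield_scale:
  assumes "y \<in> V" shows "Dfield (r *\<^sub>R X) y v = r *\<^sub>R Dfield X y v"
proof -
  have "(inv_field (r *\<^sub>R X) has_derivative (\<lambda>v. r *\<^sub>R Dfield X y v)) (at y)"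
    by (rule has_derivative_transform_within_open[OF has_derivative_scaleR_right[OF
          inv_field_has_derivative[OF assms, of X]] open_V assms])
       (simp add: linear_scale[OF linear_inv_field])
  from frechet_derivative_at[OF this] show ?thesis by (simp add: fun_eq_iff)
qed

lemma bilinear_bracket: "bilinear bracket"
  unfolding bilinear_def bracket_def
  by (auto intro!: linearI simp: Dfield_add[OF e_in_V] Dfield_scale[OF e_in_V]
      linear_add[OF linear_Dfield[OF e_in_V]] linear_scale[OF linear_Dfield[OF e_in_V]]
      scaleR_diff_right)

lemma bracket_antisym: "bracket X Y = - bracket Y X"
  by (simp add: bracket_def)

text \<open>The commutator of left-invariant fields is the left-invariant field of the bracket, not only at
the unit, where this is the definition, but on the whole domain. This makes it possible to
differentiate the commutator once more.\<close>

lemma inv_field_bracket: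
  assumes "a \<in> V"
  shows "inv_field (bracket X Y) a = Dfield Y a (inv_field X a) - Dfield X a (inv_field Y a)"
proof -
  obtain U where U: "open U" "e \<in> U" "smooth_on U (\<mu> a)"
    using smooth_slice[OF assms] by metis
  show ?thesis
    unfolding Dfield_along_inv_field[OF assms] bracket_def linear_diff[OF linear_inv_field[OF assms]]
    by (simp add: smooth_on_second_derivative_commute[OF U(1,3,2), of X Y])
qed

lemma Dfield_bracket:
  "Dfield (bracket X Y) e Z =
     frechet_derivative (\<lambda>a. Dfield Y a X) (at e) Z + Dfield Y e (Dfield X e Z)
     - (frechet_derivative (\<lambda>a. Dfield X a Y) (at e) Z + Dfield X e (Dfield Y e Z))"
proof -
  have D: "((\<lambda>a. Dfield Y a (inv_field X a)) has_derivative
      (\<lambda>Z. frechet_derivative (\<lambda>a. Dfield Y a (inv_field X e)) (at e) Z + Dfield Y e (Dfield X e Z))) (at e)"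
    for X Y
    by (rule has_derivative_apply_linear[OF open_V e_in_V linear_Dfield
          smooth_on_has_derivative[OF smooth_on_derivative[OF smooth_inv_field] e_in_V]
          inv_field_has_derivative[OF e_in_V]])
  have "(inv_field (bracket X Y) has_derivative
     (\<lambda>Z. frechet_derivative (\<lambda>a. Dfield Y a X) (at e) Z + Dfield Y e (Dfield X e Z)
     - (frechet_derivative (\<lambda>a. Dfield X a Y) (at e) Z + Dfield X e (Dfield Y e Z)))) (at e)"
    by (rule has_derivative_transform_within_open[OF has_derivative_diff[OF
          D[of Y X, unfolded inv_field_at_unit] D[of X Y, unfolded inv_field_at_unit]] open_V e_in_V])
       (simp add: inv_field_bracket)
  from frechet_derivative_at[OF this] show ?thesis by (simp add: fun_eq_iff)
qed

text \<open>After \<open>Dfield_bracket\<close> this is the usual computation for commutators of vector fields: the second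
derivatives cancel in pairs by symmetry, the products of first derivatives cancel identically.\<close>

lemma bracket_jacobi:
  "bracket (bracket X Y) Z + bracket (bracket Y Z) X + bracket (bracket Z X) Y = 0"
proof -
  have sym: "frechet_derivative (\<lambda>a. Dfield X a Y) (at e) Z = frechet_derivative (\<lambda>a. Dfield X a Z) (at e) Y"
    for X Y Z
    by (rule smooth_on_second_derivative_commute[OF open_V smooth_inv_field e_in_V])
  have b: "bracket (bracket X Y) Z = Dfield Z e (Dfield Y e X) - Dfield Z e (Dfield X e Y)
     - Dfield (bracket X Y) e Z" for X Y Z
    by (simp add: bracket_def linear_diff[OF linear_Dfield[OF e_in_V]])
  show ?thesis
    unfolding b[of X Y Z] b[of Y Z X] b[of Z X Y] Dfield_bracket
    using sym[of X Y Z] sym[of Y X Z] sym[of Z X Y]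
    by (simp add: algebra_simps)
qed

text \<open>Differentiating the homomorphism law once shows that invariant fields are related by
\<^term>\<open>\<Phi>\<close> (\<open>related\<close>); differentiating again (\<open>second\<close>) leaves a second derivative of
\<^term>\<open>\<Phi>\<close>, which cancels upon antisymmetrising.\<close>

lemma bracket_derivative_hom:
  assumes W: "open W" "e \<in> W" and smooth: "smooth_on W \<Phi>" and \<Phi>_unit: "\<Phi> e = e"
    and V: "\<And>x. x \<in> W \<Longrightarrow> x \<in> V" "\<And>x. x \<in> W \<Longrightarrow> \<Phi> x \<in> V"
    and hom: "\<And>x. x \<in> W \<Longrightarrow> \<forall>\<^sub>F y in nhds e. \<Phi> (\<mu> x y) = \<mu> (\<Phi> x) (\<Phi> y)"
  shows "frechet_derivative \<Phi> (at e) (bracket X Y)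
       = bracket (frechet_derivative \<Phi> (at e) X) (frechet_derivative \<Phi> (at e) Y)"
proof -
  let ?D = "\<lambda>x. frechet_derivative \<Phi> (at x)"
  have D: "(\<Phi> has_derivative ?D x) (at x)" if "x \<in> W" for x
    by (rule smooth_on_has_derivative[OF smooth that])
  have related: "?D x (inv_field Y x) = inv_field (?D e Y) (\<Phi> x)" if x: "x \<in> W" for x Y
  proof -
    have "((\<lambda>y. \<Phi> (\<mu> x y)) has_derivative (\<lambda>Y. ?D x (inv_field Y x))) (at e)"
      using has_derivative_compose[OF slice_differentiable[OF \<Omega>_right[OF V(1)[OF x]]], of \<Phi> "?D x"]
        D[OF x] right_unit[OF V(1)[OF x]] by (simp add: inv_field_def)
    then have 1: "((\<lambda>y. \<mu> (\<Phi> x) (\<Phi> y)) has_derivative (\<lambda>Y. ?D x (inv_field Y x))) (at e)"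
      using hom[OF x] by (rule has_derivative_transform_nhds)
    have 2: "((\<lambda>y. \<mu> (\<Phi> x) (\<Phi> y)) has_derivative (\<lambda>Y. inv_field (?D e Y) (\<Phi> x))) (at e)"
      using has_derivative_compose[OF D[OF W(2)], of "\<mu> (\<Phi> x)" "frechet_derivative (\<mu> (\<Phi> x)) (at e)"]
        slice_differentiable[OF \<Omega>_right[OF V(2)[OF x]]] \<Phi>_unit by (simp add: inv_field_def)
    show ?thesis
      using has_derivative_unique[OF 1 2] by (rule fun_cong)
  qed
  have second: "frechet_derivative (\<lambda>x. ?D x Y) (at e) X + ?D e (Dfield Y e X) = Dfield (?D e Y) e (?D e X)"
    for X Y
  proof -
    have "((\<lambda>x. ?D x (inv_field Y x)) has_derivative
       (\<lambda>X. frechet_derivative (\<lambda>x. ?D x (inv_field Y e)) (at e) X + ?D e (Dfield Y e X))) (at e)"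
      by (rule has_derivative_apply_linear[OF W has_derivative_linear[OF D]
            smooth_on_has_derivative[OF smooth_on_derivative[OF smooth] W(2)]
            inv_field_has_derivative[OF e_in_V]])
    then have 1: "((\<lambda>x. inv_field (?D e Y) (\<Phi> x)) has_derivative
       (\<lambda>X. frechet_derivative (\<lambda>x. ?D x Y) (at e) X + ?D e (Dfield Y e X))) (at e)"
      unfolding inv_field_at_unit
      by (rule has_derivative_transform_within_open[OF _ W]) (rule related)
    have 2: "((\<lambda>x. inv_field (?D e Y) (\<Phi> x)) has_derivative (\<lambda>X. Dfield (?D e Y) e (?D e X))) (at e)"
      using has_derivative_compose[OF D[OF W(2)], of "inv_field (?D e Y)" "Dfield (?D e Y) e"]
        inv_field_has_derivative[OF e_in_V] \<Phi>_unit by simp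
    show ?thesis
      using has_derivative_unique[OF 1 2] by (rule fun_cong)
  qed
  show ?thesis
    unfolding bracket_def second[symmetric] linear_diff[OF has_derivative_linear[OF D[OF W(2)]]]
    by (simp add: smooth_on_second_derivative_commute[OF W(1) smooth W(2), of X Y])
qed

end

section \<open>Lie groups in charts\<close>

context lie_group
begin

abbreviation coords :: "('g, 'd) chart \<Rightarrow> (real^'d) set" where
  "coords c \<equiv> snd c ` fst c"

lemma chart_homeomorphic:
  "c \<in> \<A> \<Longrightarrow> homeomorphic_map (subtopology T (fst c)) (top_of_set (coords c)) (snd c)"
  using atlas unfolding smooth_atlas_def by blast

lemma chart_openin: "c \<in> \<A> \<Longrightarrow> openin T (fst c)"
  using atlas unfolding smooth_atlas_def by blast

lemma open_coords: "c \<in> \<A> \<Longrightarrow> open (coords c)"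
  using atlas unfolding smooth_atlas_def by blast

lemma chart_carrier: "c \<in> \<A> \<Longrightarrow> fst c \<subseteq> carrier G"
  using chart_openin openin_subset topspace_eq by blast

lemma topspace_chart: "c \<in> \<A> \<Longrightarrow> topspace (subtopology T (fst c)) = fst c"
  by (rule topspace_subtopology_subset[OF openin_subset[OF chart_openin]])

lemma chart_inj: "c \<in> \<A> \<Longrightarrow> inj_on (snd c) (fst c)"
  using homeomorphic_imp_injective_map[OF chart_homeomorphic] topspace_chart by metis

lemma chart_around:
  assumes "a \<in> carrier G" obtains c where "c \<in> \<A>" "a \<in> fst c"
  using assms atlas unfolding smooth_atlas_def topspace_eq by blast

lemma chart_inv_in: "x \<in> coords c \<Longrightarrow> chart_inv c x \<in> fst c"
  unfolding chart_inv_def by (rule inv_into_into)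

lemma coord_chart_inv: "x \<in> coords c \<Longrightarrow> snd c (chart_inv c x) = x"
  unfolding chart_inv_def by (rule f_inv_into_f)

lemma chart_inv_coord: "c \<in> \<A> \<Longrightarrow> a \<in> fst c \<Longrightarrow> chart_inv c (snd c a) = a"
  unfolding chart_inv_def by (rule inv_into_f_f[OF chart_inj])

lemma chart_inv_carrier: "c \<in> \<A> \<Longrightarrow> x \<in> coords c \<Longrightarrow> chart_inv c x \<in> carrier G"
  using chart_inv_in chart_carrier by blast

lemma continuous_chart_inv:
  assumes "c \<in> \<A>"
  shows "continuous_map (top_of_set (coords c)) T (chart_inv c)"
proof -
  obtain g where g: "homeomorphic_maps (subtopology T (fst c)) (top_of_set (coords c)) (snd c) g"
    using chart_homeomorphic[OF assms] homeomorphic_map_maps by blast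
  then have "continuous_map (top_of_set (coords c)) T g"
    by (simp add: homeomorphic_maps_def continuous_map_in_subtopology)
  moreover have "g x = chart_inv c x" if "x \<in> coords c" for x
    using g that topspace_chart[OF assms] chart_inv_coord[OF assms]
    unfolding homeomorphic_maps_def by auto
  ultimately show ?thesis
    by (auto intro: continuous_map_eq)
qed

abbreviation mult_domain ::
  "('g, 'd) chart \<Rightarrow> ('g, 'd) chart \<Rightarrow> ('g, 'd) chart \<Rightarrow> ((real^'d) \<times> (real^'d)) set" where
  "mult_domain c1 c2 c3 \<equiv> {(x, y). x \<in> coords c1 \<and> y \<in> coords c2 \<and>
     chart_inv c1 x \<otimes> chart_inv c2 y \<in> fst c3}"

lemma open_mult_domain:
  assumes "c1 \<in> \<A>" "c2 \<in> \<A>" "c3 \<in> \<A>"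
  shows "open (mult_domain c1 c2 c3)"
proof -
  let ?X = "top_of_set (coords c1 \<times> coords c2)"
  have "continuous_map ?X T (\<lambda>p. chart_inv c1 (fst p))"
    using continuous_map_compose[OF _ continuous_chart_inv[OF assms(1)], of ?X fst]
    by (simp add: o_def continuous_on_fst continuous_on_id mem_Times_iff Pi_iff)
  moreover have "continuous_map ?X T (\<lambda>p. chart_inv c2 (snd p))"
    using continuous_map_compose[OF _ continuous_chart_inv[OF assms(2)], of ?X snd]
    by (simp add: o_def continuous_on_snd continuous_on_id mem_Times_iff Pi_iff)
  ultimately have "continuous_map ?X (prod_topology T T) (\<lambda>p. (chart_inv c1 (fst p), chart_inv c2 (snd p)))"
    by (rule continuous_map_pairedI)
  from continuous_map_compose[OF this continuous_mult]
  have "continuous_map ?X T (\<lambda>p. chart_inv c1 (fst p) \<otimes> chart_inv c2 (snd p))"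
    by (simp add: o_def)
  from openin_continuous_map_preimage[OF this chart_openin[OF assms(3)]]
  have "openin ?X {p \<in> topspace ?X. chart_inv c1 (fst p) \<otimes> chart_inv c2 (snd p) \<in> fst c3}" .
  moreover have "{p \<in> topspace ?X. chart_inv c1 (fst p) \<otimes> chart_inv c2 (snd p) \<in> fst c3} = mult_domain c1 c2 c3"
    by auto
  moreover have "open (coords c1 \<times> coords c2)"
    using open_coords assms by (simp add: open_Times)
  ultimately show ?thesis
    using openin_open_trans by force
qed

end

locale lie_group_chart = lie_group G T \<A>
  for G :: "'g monoid" (structure) and T :: "'g topology" and \<A> :: "('g, 'd::finite) chart set" +
  fixes c :: "('g, 'd) chart"
  assumes chart_in_atlas: "c \<in> \<A>" and one_in_chart: "\<one> \<in> fst c"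
begin

abbreviation mult_coords :: "real^'d \<Rightarrow> real^'d \<Rightarrow> real^'d" where
  "mult_coords x y \<equiv> snd c (chart_inv c x \<otimes> chart_inv c y)"

lemma chart_one_coords: "chart_one G c \<in> coords c"
  by (simp add: chart_one_def one_in_chart)

lemma chart_inv_chart_one: "chart_inv c (chart_one G c) = \<one>"
  by (simp add: chart_one_def chart_inv_coord chart_in_atlas one_in_chart)

sublocale local_group_law "coords c" "mult_domain c c c" mult_coords "chart_one G c"
proof
  show "open (coords c)" "open (mult_domain c c c)"
    using open_coords open_mult_domain chart_in_atlas by auto
  show "chart_one G c \<in> coords c"
    by (rule chart_one_coords)
  show "smooth_on (mult_domain c c c) (\<lambda>(x, y). mult_coords x y)"
    by (rule smooth_mult[OF chart_in_atlas chart_in_atlas chart_in_atlas])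
  fix x assume x: "x \<in> coords c"
  then have "chart_inv c x \<in> carrier G" "chart_inv c x \<in> fst c"
    using chart_inv_carrier chart_in_atlas chart_inv_in by auto
  then show "(x, chart_one G c) \<in> mult_domain c c c"
    "mult_coords x (chart_one G c) = x" "mult_coords (chart_one G c) x = x"
    using x chart_one_coords by (auto simp: chart_inv_chart_one coord_chart_inv)
next
  fix x y assume xy: "(x, y) \<in> mult_domain c c c"
  then show "mult_coords x y \<in> coords c" "y \<in> coords c"
    by auto
  have "(y, chart_one G c) \<in> mult_domain c c c"
    using xy chart_inv_carrier chart_in_atlas chart_inv_in chart_one_coords
    by (auto simp: chart_inv_chart_one)
  moreover have "open ((\<lambda>z. (y, z)) -` mult_domain c c c)"
    by (rule open_vimage[OF open_mult_domain[OF chart_in_atlas chart_in_atlas chart_in_atlas]])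
       (intro continuous_intros)
  ultimately have "\<forall>\<^sub>F z in nhds (chart_one G c). (y, z) \<in> mult_domain c c c"
    using eventually_nhds_in_open by force
  then show "\<forall>\<^sub>F z in nhds (chart_one G c).
      mult_coords (mult_coords x y) z = mult_coords x (mult_coords y z)"
  proof eventually_elim
    case (elim z)
    then show ?case
      using xy chart_inv_carrier[OF chart_in_atlas] chart_inv_coord[OF chart_in_atlas]
      by (simp add: m_assoc)
  qed
qed

lemma lie_bracket_eq: "lie_bracket G c = bracket"
proof -
  have "left_invariant_field G c X = inv_field X" for X
    by (rule ext) (simp add: left_invariant_field_def inv_field_def)
  then show ?thesis
    by (intro ext) (simp add: lie_bracket_def bracket_def)
qed

abbreviation conj_coords :: "'g \<Rightarrow> real^'d \<Rightarrow> real^'d" where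
  "conj_coords a x \<equiv> snd c (a \<otimes> chart_inv c x \<otimes> inv a)"

text \<open>The element \<^term>\<open>a\<close> need not lie in the domain of \<^term>\<open>c\<close>, so conjugation is factored as left
translation into a chart around \<^term>\<open>a\<close> followed by right translation back, with a third chart
around the inverse of \<^term>\<open>a\<close>; each step is the smooth multiplication with one argument fixed.\<close>

lemma smooth_conj_coords:
  assumes a: "a \<in> carrier G"
  obtains W where "open W" "chart_one G c \<in> W" "W \<subseteq> coords c"
    "\<forall>x\<in>W. a \<otimes> chart_inv c x \<otimes> inv a \<in> fst c" "smooth_on W (conj_coords a)"
proof -
  obtain c1 where c1: "c1 \<in> \<A>" "a \<in> fst c1" using chart_around[OF a] by blast
  obtain c2 where c2: "c2 \<in> \<A>" "inv a \<in> fst c2" using chart_around[OF inv_closed[OF a]] by blast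
  note c = chart_in_atlas
  define \<psi> where "\<psi> = (\<lambda>x. snd c1 (a \<otimes> chart_inv c x))"
  define W1 where "W1 = {x \<in> coords c. a \<otimes> chart_inv c x \<in> fst c1}"
  have W1_eq: "W1 = (\<lambda>x. (snd c1 a, x)) -` mult_domain c1 c c1"
    using c1 by (auto simp: W1_def chart_inv_coord)
  have "open W1"
    unfolding W1_eq by (rule open_vimage[OF open_mult_domain[OF c1(1) c c1(1)]]) (intro continuous_intros)
  have "smooth_on W1 (\<lambda>x. (\<lambda>(x, y). snd c1 (chart_inv c1 x \<otimes> chart_inv c y))
      ((snd c1 a, 0) + (0, x)))"
    by (rule smooth_on_compose[OF \<open>open W1\<close> _ smooth_on_affine[OF \<open>open W1\<close>] smooth_mult[OF c1(1) c c1(1)]])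
       (auto simp: W1_eq intro!: bounded_linear_intros)
  then have \<psi>: "smooth_on W1 \<psi>"
    using c1 by (simp add: \<psi>_def chart_inv_coord)
  define W where "W = {x \<in> W1. a \<otimes> chart_inv c x \<otimes> inv a \<in> fst c}"
  have W_eq: "W = W1 \<inter> (\<lambda>x. (\<psi> x, snd c2 (inv a))) -` mult_domain c1 c2 c"
  proof -
    have "(\<psi> x, snd c2 (inv a)) \<in> mult_domain c1 c2 c \<longleftrightarrow> a \<otimes> chart_inv c x \<otimes> inv a \<in> fst c"
      if "x \<in> W1" for x
    proof -
      have "a \<otimes> chart_inv c x \<in> fst c1"
        using that by (simp add: W1_def)
      then show ?thesis
        using c2 by (simp add: \<psi>_def chart_inv_coord[OF c1(1)] chart_inv_coord[OF c2(1)])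
    qed
    then show ?thesis
      by (auto simp: W_def)
  qed
  have "continuous_on W1 \<psi>"
    using \<psi> unfolding smooth_on_def by (metis Ck_on.simps(1))
  then have "open W"
    unfolding W_eq
    by (intro continuous_open_preimage[OF _ \<open>open W1\<close> open_mult_domain[OF c1(1) c2(1) c]] continuous_intros)
  have \<psi>': "smooth_on W \<psi>"
    by (rule smooth_on_subset[OF \<psi>]) (auto simp: W_def)
  have L: "smooth_on UNIV (\<lambda>y. (0, snd c2 (inv a)) + (y, 0))"
    by (rule smooth_on_affine[OF open_UNIV]) (auto intro!: bounded_linear_intros)
  have P: "smooth_on W (\<lambda>x. (0, snd c2 (inv a)) + (\<psi> x, 0))"
    by (rule smooth_on_compose[OF \<open>open W\<close> subset_UNIV \<psi>' L])
  have "smooth_on W (\<lambda>x. (\<lambda>(x, y). snd c (chart_inv c1 x \<otimes> chart_inv c2 y))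
      ((0, snd c2 (inv a)) + (\<psi> x, 0)))"
    by (rule smooth_on_compose[OF \<open>open W\<close> _ P smooth_mult[OF c1(1) c2(1) c]]) (auto simp: W_eq)
  then have "smooth_on W (conj_coords a)"
    by (rule smooth_on_cong[OF \<open>open W\<close>, rotated])
       (use c1 c2 in \<open>auto simp: W_def W1_def \<psi>_def chart_inv_coord\<close>)
  moreover have "chart_one G c \<in> W"
    using a c1(2) one_in_chart chart_one_coords by (simp add: W_def W1_def chart_inv_chart_one)
  moreover have "W \<subseteq> coords c" "\<forall>x\<in>W. a \<otimes> chart_inv c x \<otimes> inv a \<in> fst c"
    unfolding W_def W1_def by blast+
  ultimately show ?thesis
    using that[of W] \<open>open W\<close> by blast
qed

lemma conj_coords_one: "a \<in> carrier G \<Longrightarrow> conj_coords a (chart_one G c) = chart_one G c"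
  using chart_inv_chart_one by (simp add: chart_one_def)

lemma adjoint_rep_has_derivative:
  assumes "a \<in> carrier G"
  shows "(conj_coords a has_derivative adjoint_rep G c a) (at (chart_one G c))"
proof -
  obtain W where W: "open W" "chart_one G c \<in> W" "W \<subseteq> coords c"
    "\<forall>x\<in>W. a \<otimes> chart_inv c x \<otimes> inv a \<in> fst c" "smooth_on W (conj_coords a)"
    by (rule smooth_conj_coords[OF assms])
  have "adjoint_rep G c a = frechet_derivative (conj_coords a) (at (chart_one G c))"
    by (rule ext) (simp add: adjoint_rep_def)
  then show ?thesis
    using smooth_on_has_derivative[OF W(5,2)] by simp
qed

lemma linear_adjoint_rep: "a \<in> carrier G \<Longrightarrow> linear (adjoint_rep G c a)"
  by (rule has_derivative_linear[OF adjoint_rep_has_derivative])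

lemma inv_cancel_left: "a \<in> carrier G \<Longrightarrow> x \<in> carrier G \<Longrightarrow> inv a \<otimes> (a \<otimes> x) = x"
  by (simp add: m_assoc[symmetric])

lemma adjoint_rep_bracket:
  assumes a: "a \<in> carrier G"
  shows "adjoint_rep G c a (lie_bracket G c X Y)
       = lie_bracket G c (adjoint_rep G c a X) (adjoint_rep G c a Y)"
proof -
  obtain W where W: "open W" "chart_one G c \<in> W" "W \<subseteq> coords c"
    "\<forall>x\<in>W. a \<otimes> chart_inv c x \<otimes> inv a \<in> fst c" "smooth_on W (conj_coords a)"
    by (rule smooth_conj_coords[OF a])
  have hom: "\<forall>\<^sub>F y in nhds (chart_one G c).
      conj_coords a (mult_coords x y) = mult_coords (conj_coords a x) (conj_coords a y)"
    if x: "x \<in> W" for x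
  proof -
    have "(x, chart_one G c) \<in> mult_domain c c c"
      by (rule \<Omega>_right) (use x W(3) in blast)
    moreover have "open ((\<lambda>z. (x, z)) -` mult_domain c c c)"
      by (rule open_vimage[OF open_\<Omega>]) (intro continuous_intros)
    ultimately have "\<forall>\<^sub>F y in nhds (chart_one G c). (x, y) \<in> mult_domain c c c"
      using eventually_nhds_in_open by force
    with eventually_nhds_in_open[OF W(1,2)] show ?thesis
    proof eventually_elim
      case (elim y)
      let ?x = "chart_inv c x" and ?y = "chart_inv c y"
      have xy: "?x \<in> carrier G" "?y \<in> carrier G"
        using x elim W(3) chart_inv_carrier[OF chart_in_atlas] by auto
      have "conj_coords a (mult_coords x y) = snd c (a \<otimes> (?x \<otimes> ?y) \<otimes> inv a)"
        using elim chart_inv_coord[OF chart_in_atlas] by simp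
      also have "a \<otimes> (?x \<otimes> ?y) \<otimes> inv a = (a \<otimes> ?x \<otimes> inv a) \<otimes> (a \<otimes> ?y \<otimes> inv a)"
        using a xy by (simp add: m_assoc inv_cancel_left)
      also have "snd c \<dots> = mult_coords (conj_coords a x) (conj_coords a y)"
        using W(4) x elim chart_inv_coord[OF chart_in_atlas] by simp
      finally show ?case .
    qed
  qed
  have ad: "adjoint_rep G c a = frechet_derivative (conj_coords a) (at (chart_one G c))"
    by (rule ext) (simp add: adjoint_rep_def)
  show ?thesis
    unfolding lie_bracket_eq ad
    by (rule bracket_derivative_hom[OF W(1,2,5) conj_coords_one[OF a] _ _ hom]) (use W in auto)
qed

lemma adjoint_rep_inverse:
  assumes a: "a \<in> carrier G"
  shows "adjoint_rep G c (inv a) (adjoint_rep G c a X) = X"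
proof -
  obtain W where W: "open W" "chart_one G c \<in> W" "W \<subseteq> coords c"
    "\<forall>x\<in>W. a \<otimes> chart_inv c x \<otimes> inv a \<in> fst c" "smooth_on W (conj_coords a)"
    by (rule smooth_conj_coords[OF a])
  have "conj_coords (inv a) (conj_coords a x) = x" if x: "x \<in> W" for x
  proof -
    have "chart_inv c x \<in> carrier G"
      using x W(3) chart_inv_carrier[OF chart_in_atlas] by blast
    then have "inv a \<otimes> (a \<otimes> chart_inv c x \<otimes> inv a) \<otimes> inv (inv a) = chart_inv c x"
      using a by (simp add: m_assoc inv_cancel_left)
    then show ?thesis
      using x W(3) by (simp add: chart_inv_coord[OF chart_in_atlas bspec[OF W(4) x]] coord_chart_inv subset_eq)
  qed
  then have 1: "((\<lambda>x. conj_coords (inv a) (conj_coords a x)) has_derivative (\<lambda>X. X)) (at (chart_one G c))"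
    by (intro has_derivative_transform_within_open[OF has_derivative_ident W(1,2)]) simp
  have 2: "((\<lambda>x. conj_coords (inv a) (conj_coords a x)) has_derivative
      (\<lambda>X. adjoint_rep G c (inv a) (adjoint_rep G c a X))) (at (chart_one G c))"
    using has_derivative_compose[OF adjoint_rep_has_derivative[OF a],
        of "conj_coords (inv a)" "adjoint_rep G c (inv a)"]
      adjoint_rep_has_derivative[OF inv_closed[OF a]] by (simp add: conj_coords_one[OF a])
  show ?thesis
    using has_derivative_unique[OF 2 1] by (rule fun_cong)
qed

end

section \<open>The Killing form\<close>

lemma trace_matrix: "trace (matrix f) = (\<Sum>i\<in>UNIV. f (axis i 1) $ i)"
  by (simp add: trace_def matrix_def)

lemma trace_matrix_commute:
  fixes f g :: "real^'d \<Rightarrow> real^'d"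
  assumes "linear f" "linear g"
  shows "trace (matrix (\<lambda>x. f (g x))) = trace (matrix (\<lambda>x. g (f x)))"
proof -
  have "trace (matrix (f \<circ> g)) = trace (matrix (g \<circ> f))"
    unfolding matrix_compose[OF assms] matrix_compose[OF assms(2,1)] by (rule trace_mul_sym)
  then show ?thesis by (simp add: o_def)
qed

lemma linear_bilinear_right: "bilinear f \<Longrightarrow> linear (f x)"
  by (simp add: bilinear_def eta_contract_eq)

lemma linear_bilinear_left: "bilinear f \<Longrightarrow> linear (\<lambda>x. f x y)"
  by (simp add: bilinear_def)

lemma killing_form_sym:
  assumes "bilinear br"
  shows "killing_form br X Y = killing_form br Y X"
  unfolding killing_form_def
  by (rule trace_matrix_commute[OF linear_bilinear_right[OF assms] linear_bilinear_right[OF assms]])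

lemma bilinear_killing_form:
  assumes "bilinear br"
  shows "bilinear (killing_form br)"
proof -
  have "linear (killing_form br X)" for X
    by (rule linearI)
       (auto simp: killing_form_def trace_matrix bilinear_ladd[OF assms] bilinear_radd[OF assms]
         bilinear_lmul[OF assms] bilinear_rmul[OF assms] sum.distrib sum_distrib_left)
  then show ?thesis
    unfolding bilinear_def using killing_form_sym[OF assms] by (simp add: eta_contract_eq)
qed

text \<open>By the Jacobi identity \<open>ad [X, Y]\<close> is a commutator of endomorphisms, and the claim becomes
cyclicity of the trace.\<close>

lemma killing_form_ad_invariant:
  assumes bil: "bilinear br" and anti: "\<And>X Y. br X Y = - br Y X"
    and jacobi: "\<And>X Y Z. br (br X Y) Z + br (br Y Z) X + br (br Z X) Y = 0"
  shows "killing_form br (br X Y) Z = - killing_form br Y (br X Z)"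
proof -
  note lin = linear_bilinear_right[OF bil]
  have ad: "br (br X Y) W = br X (br Y W) - br Y (br X W)" for X Y W
  proof -
    have "br (br Y W) X = - br X (br Y W)" "br (br W X) Y = br Y (br X W)"
      using anti[of "br Y W" X] anti[of "br W X" Y] anti[of W X] linear_neg[OF lin] by auto
    then show ?thesis
      using jacobi[of X Y W] by (simp add: algebra_simps add_eq_0_iff)
  qed
  have "killing_form br (br X Y) Z =
      trace (matrix (\<lambda>W. br X (br Y (br Z W)))) - trace (matrix (\<lambda>W. br Y (br X (br Z W))))"
    by (simp add: killing_form_def trace_matrix ad sum_subtractf)
  moreover have "killing_form br Y (br X Z) =
      trace (matrix (\<lambda>W. br Y (br X (br Z W)))) - trace (matrix (\<lambda>W. br Y (br Z (br X W))))"
    by (simp add: killing_form_def trace_matrix ad sum_subtractf linear_diff[OF lin])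
  moreover have "trace (matrix (\<lambda>W. br X (br Y (br Z W)))) = trace (matrix (\<lambda>W. br Y (br Z (br X W))))"
    using trace_matrix_commute[OF lin[of X] linear_compose[OF lin[of Z] lin[of Y]]]
    by (simp add: o_def)
  ultimately show ?thesis by simp
qed

text \<open>An automorphism conjugates \<open>ad X\<close> into \<open>ad (f X)\<close>, and traces are invariant under conjugation.\<close>

lemma killing_form_automorphism:
  assumes bil: "bilinear br" and lin: "linear f" "linear f'"
    and inv: "\<And>X. f' (f X) = X" "\<And>X. f (f' X) = X"
    and hom: "\<And>X Y. f (br X Y) = br (f X) (f Y)"
  shows "killing_form br (f X) (f Y) = killing_form br X Y"
proof -
  have "br (f X) (br (f Y) W) = f (br X (br Y (f' W)))" for W
    by (simp add: hom inv)
  then have "killing_form br (f X) (f Y) = trace (matrix (\<lambda>W. f (br X (br Y (f' W)))))"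
    by (simp add: killing_form_def)
  also have "\<dots> = trace (matrix (\<lambda>W. (br X (br Y (f' (f W))))))"
    using trace_matrix_commute[OF lin(1) linear_compose[OF lin(2)
        linear_compose[OF linear_bilinear_right[OF bil, of Y] linear_bilinear_right[OF bil, of X]]]]
    by (simp add: o_def)
  finally show ?thesis
    by (simp add: killing_form_def inv)
qed

section \<open>Orthonormal frames and tensors of type (0,3)\<close>

lemma linear_on_set_sum:
  assumes "linear_on_set V f" "subspace V" "\<And>i. i \<in> I \<Longrightarrow> v i \<in> V"
  shows "f (\<Sum>i\<in>I. r i *\<^sub>R v i) = (\<Sum>i\<in>I. r i *\<^sub>R f (v i))"
proof -
  have "f (0 *\<^sub>R 0) = 0 *\<^sub>R f 0"
    using assms(1,2) subspace_0 unfolding linear_on_set_def by blast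
  then have f0: "f 0 = 0" by simp
  show ?thesis
    using assms(3)
  proof (induction I rule: infinite_finite_induct)
    case (insert i I)
    then have "r i *\<^sub>R v i \<in> V" "(\<Sum>i\<in>I. r i *\<^sub>R v i) \<in> V" "v i \<in> V"
      using assms(2) by (auto intro: subspace_scale subspace_sum)
    then show ?case
      using insert assms(1) by (simp add: linear_on_set_def)
  qed (auto simp: f0)
qed

lemma orthonormal_frame_expansion:
  assumes E: "orthonormal_frame V g E" and lin: "\<And>Y. Y \<in> V \<Longrightarrow> linear_on_set V (\<lambda>X. g X Y)"
    and X: "X \<in> V"
  shows "X = (\<Sum>e\<in>E. g X e *\<^sub>R e)"
proof -
  have fin: "finite E" and span: "span E = V"
    using E by (auto simp: orthonormal_frame_def)
  then have EV: "e \<in> V" if "e \<in> E" for e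
    using that span_base by blast
  obtain r where r: "X = (\<Sum>e\<in>E. r e *\<^sub>R e)"
    using X span span_finite[OF fin] by auto
  have "g X f = r f" if f: "f \<in> E" for f
  proof -
    have "g X f = (\<Sum>e\<in>E. r e *\<^sub>R g e f)"
      unfolding r using linear_on_set_sum[OF lin[OF EV[OF f]], where v = "\<lambda>e. e"] EV span subspace_span
      by auto
    also have "\<dots> = (\<Sum>e\<in>E. if e = f then r e else 0)"
      by (rule sum.cong) (use E f in \<open>auto simp: orthonormal_frame_def\<close>)
    also have "\<dots> = r f" using fin f by simp
    finally show ?thesis .
  qed
  then show ?thesis using r by simp
qed

text \<open>The model case is the orthogonal projection \<open>P\<close> onto a summand and a map \<open>\<psi>\<close> that factors through
\<open>P\<close> and has values in the complementary summand: \<open>\<psi>\<close> is then strictly triangular, and the sum is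
its trace. Expanding twice in the frame moves \<open>P\<close> from one factor to the other.\<close>

lemma orthonormal_frame_trace_offdiagonal:
  assumes E: "orthonormal_frame V g E"
    and lin: "\<And>Y. Y \<in> V \<Longrightarrow> linear_on_set V (\<lambda>X. g X Y)" and sym: "\<And>X Y. g X Y = g Y X"
    and P: "\<And>X. X \<in> V \<Longrightarrow> P X \<in> V" "\<And>X Y. X \<in> V \<Longrightarrow> Y \<in> V \<Longrightarrow> g (P X) Y = g X (P Y)"
    and \<psi>: "\<And>X. X \<in> V \<Longrightarrow> \<psi> X \<in> V" "linear_on_set V \<psi>" "\<And>X. X \<in> V \<Longrightarrow> \<psi> (P X) = \<psi> X"
      "\<And>X. X \<in> V \<Longrightarrow> g (P X) (\<psi> X) = 0"
  shows "(\<Sum>e\<in>E. g e (\<psi> e)) = 0"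
proof -
  have V: "subspace V" and EV: "\<And>e. e \<in> E \<Longrightarrow> e \<in> V"
    using E span_base subspace_span by (auto simp: orthonormal_frame_def)
  note expansion = orthonormal_frame_expansion[OF E lin]
  have "g e (\<psi> e) = (\<Sum>f\<in>E. g e (P f) * g e (\<psi> f))" if e: "e \<in> E" for e
  proof -
    have "\<psi> e = \<psi> (\<Sum>f\<in>E. g (P e) f *\<^sub>R f)"
      using expansion[of "P e"] P(1) \<psi>(3) e EV by simp
    also have "\<dots> = (\<Sum>f\<in>E. g (P e) f *\<^sub>R \<psi> f)"
      using linear_on_set_sum[OF \<psi>(2) V, where v = "\<lambda>f. f"] EV by blast
    finally have "g e (\<psi> e) = g (\<Sum>f\<in>E. g (P e) f *\<^sub>R \<psi> f) e"
      by (simp add: sym[of e])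
    also have "\<dots> = (\<Sum>f\<in>E. g (P e) f *\<^sub>R g (\<psi> f) e)"
      using linear_on_set_sum[OF lin[OF EV[OF e]] V, where v = \<psi>] EV \<psi>(1) by blast
    also have "\<dots> = (\<Sum>f\<in>E. g e (P f) * g e (\<psi> f))"
      by (rule sum.cong) (use P(2) EV e sym in auto)
    finally show ?thesis .
  qed
  then have "(\<Sum>e\<in>E. g e (\<psi> e)) = (\<Sum>e\<in>E. \<Sum>f\<in>E. g e (P f) * g e (\<psi> f))"
    by (rule sum.cong[OF refl])
  also have "\<dots> = (\<Sum>f\<in>E. \<Sum>e\<in>E. g e (P f) * g e (\<psi> f))"
    by (rule sum.swap)
  also have "\<dots> = (\<Sum>f\<in>E. g (P f) (\<psi> f))"
  proof (rule sum.cong[OF refl])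
    fix f assume f: "f \<in> E"
    have "g (P f) (\<psi> f) = g (\<Sum>e\<in>E. g (P f) e *\<^sub>R e) (\<psi> f)"
      using expansion[of "P f"] P(1) f EV by simp
    also have "\<dots> = (\<Sum>e\<in>E. g (P f) e *\<^sub>R g e (\<psi> f))"
      using linear_on_set_sum[OF lin[OF \<psi>(1)[OF EV[OF f]]] V, where v = "\<lambda>e. e"] EV by blast
    finally show "(\<Sum>e\<in>E. g e (P f) * g e (\<psi> f)) = g (P f) (\<psi> f)"
      by (simp add: sym[of "P f" e for e])
  qed
  also have "\<dots> = 0"
    using \<psi>(4) EV by simp
  finally show ?thesis .
qed

lemma tensor_spaceI:
  assumes "\<And>X X' Y Z. \<lbrakk>X \<in> V; X' \<in> V; Y \<in> V; Z \<in> V\<rbrakk> \<Longrightarrow> A (X + X') Y Z = A X Y Z + A X' Y Z"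
    and "\<And>X X' Y Z. \<lbrakk>X \<in> V; X' \<in> V; Y \<in> V; Z \<in> V\<rbrakk> \<Longrightarrow> A Y (X + X') Z = A Y X Z + A Y X' Z"
    and "\<And>X X' Y Z. \<lbrakk>X \<in> V; X' \<in> V; Y \<in> V; Z \<in> V\<rbrakk> \<Longrightarrow> A Y Z (X + X') = A Y Z X + A Y Z X'"
    and "\<And>r X Y Z. \<lbrakk>X \<in> V; Y \<in> V; Z \<in> V\<rbrakk> \<Longrightarrow> A (r *\<^sub>R X) Y Z = r * A X Y Z"
    and "\<And>r X Y Z. \<lbrakk>X \<in> V; Y \<in> V; Z \<in> V\<rbrakk> \<Longrightarrow> A Y (r *\<^sub>R X) Z = r * A Y X Z"
    and "\<And>r X Y Z. \<lbrakk>X \<in> V; Y \<in> V; Z \<in> V\<rbrakk> \<Longrightarrow> A Y Z (r *\<^sub>R X) = r * A Y Z X"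
    and "\<And>X Y Z. \<lbrakk>X \<in> V; Y \<in> V; Z \<in> V\<rbrakk> \<Longrightarrow> A X Z Y = - A X Y Z"
  shows "A \<in> tensor_space V"
proof -
  have "A X Y Z + A X Z Y = 0" if "X \<in> V" "Y \<in> V" "Z \<in> V" for X Y Z
    by (simp add: assms(7)[OF that])
  then show ?thesis
    by (simp add: tensor_space_def linear_on_set_def assms(1-6))
qed

lemma tensor_spaceD:
  assumes "A \<in> tensor_space V" "X \<in> V" "Y \<in> V" "Z \<in> V"
  shows "X' \<in> V \<Longrightarrow> A (X + X') Y Z = A X Y Z + A X' Y Z"
    and "X' \<in> V \<Longrightarrow> A Y (X + X') Z = A Y X Z + A Y X' Z"
    and "X' \<in> V \<Longrightarrow> A Y Z (X + X') = A Y Z X + A Y Z X'"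
    and "A (r *\<^sub>R X) Y Z = r * A X Y Z"
    and "A Y (r *\<^sub>R X) Z = r * A Y X Z"
    and "A Y Z (r *\<^sub>R X) = r * A Y Z X"
    and "A X Z Y = - A X Y Z"
proof -
  have "linear_on_set V (\<lambda>X. A X Y Z)" "linear_on_set V (\<lambda>X. A Y X Z)" "linear_on_set V (\<lambda>X. A Y Z X)"
    using assms by (simp_all add: tensor_space_def)
  then show "X' \<in> V \<Longrightarrow> A (X + X') Y Z = A X Y Z + A X' Y Z"
    "X' \<in> V \<Longrightarrow> A Y (X + X') Z = A Y X Z + A Y X' Z"
    "X' \<in> V \<Longrightarrow> A Y Z (X + X') = A Y Z X + A Y Z X'"
    "A (r *\<^sub>R X) Y Z = r * A X Y Z" "A Y (r *\<^sub>R X) Z = r * A Y X Z"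
    "A Y Z (r *\<^sub>R X) = r * A Y Z X"
    using assms(2) by (simp_all add: linear_on_set_def)
  have "A X Y Z + A X Z Y = 0"
    using assms by (simp add: tensor_space_def)
  then show "A X Z Y = - A X Y Z" by simp
qed

lemma tensor_space_scale:
  assumes "A \<in> tensor_space V"
  shows "(\<lambda>X Y Z. r * A X Y Z) \<in> tensor_space V"
proof (rule tensor_spaceI)
  fix X Y Z assume "X \<in> V" "Y \<in> V" "Z \<in> V"
  then show "r * A X Z Y = - (r * A X Y Z)"
    by (subst tensor_spaceD(7)[OF assms]) simp_all
qed (simp_all add: tensor_spaceD(1-6)[OF assms] distrib_left)

lemma tensor_space_diff:
  assumes "A \<in> tensor_space V" "A' \<in> tensor_space V"
  shows "(\<lambda>X Y Z. A X Y Z - A' X Y Z) \<in> tensor_space V"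
proof (rule tensor_spaceI)
  fix X Y Z assume "X \<in> V" "Y \<in> V" "Z \<in> V"
  then show "A X Z Y - A' X Z Y = - (A X Y Z - A' X Y Z)"
    using tensor_spaceD(7)[OF assms(1), of X Y Z] tensor_spaceD(7)[OF assms(2), of X Y Z] by linarith
qed (simp_all add: tensor_spaceD(1-6)[OF assms(1)] tensor_spaceD(1-6)[OF assms(2)] algebra_simps)

text \<open>For a tensor that is skew in its last two arguments, the sum over all six permutations vanishes:
the odd ones contribute the negatives of the even ones. Exchanging two arguments of the cyclic
mean exchanges the two classes.\<close>

lemma tensor_space_cyclic_mean:
  assumes "A \<in> tensor_space V"
  shows "(\<lambda>X Y Z. (A X Y Z + A Y Z X + A Z X Y) / 3) \<in> type_A2 V"
proof -
  have skew: "A X Z Y = - A X Y Z" if "X \<in> V" "Y \<in> V" "Z \<in> V" for X Y Z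
    using tensor_spaceD(7)[OF assms that] .
  have alt: "A X Y Z + A Y Z X + A Z X Y + (A X Z Y + A Z Y X + A Y X Z) = 0"
    if "X \<in> V" "Y \<in> V" "Z \<in> V" for X Y Z
    using skew[OF that(1,2,3)] skew[OF that(2,3,1)] skew[OF that(3,1,2)] by linarith
  let ?M = "\<lambda>X Y Z. (A X Y Z + A Y Z X + A Z X Y) / 3"
  have "?M \<in> tensor_space V"
  proof (rule tensor_spaceI)
    fix X Y Z assume "X \<in> V" "Y \<in> V" "Z \<in> V"
    from alt[OF this] have "A X Z Y + A Z Y X + A Y X Z = - (A X Y Z + A Y Z X + A Z X Y)"
      by linarith
    then show "?M X Z Y = - ?M X Y Z"
      by (simp only: minus_divide_left)
  qed (simp_all add: tensor_spaceD(1-6)[OF assms] add_divide_distrib distrib_left)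
  moreover have "?M X Y Z + ?M Y X Z = 0" if "X \<in> V" "Y \<in> V" "Z \<in> V" for X Y Z
  proof -
    have "A Y X Z + A X Z Y + A Z Y X = - (A X Y Z + A Y Z X + A Z X Y)"
      using alt[OF that] by linarith
    then show ?thesis
      by (simp only: minus_divide_left[symmetric] right_minus)
  qed
  ultimately show ?thesis
    unfolding type_A2_def by blast
qed

text \<open>Subtracting the cyclic mean leaves a tensor with vanishing cyclic sum. The mean is totally skew
and so does not change the trace.\<close>

lemma tensor_A2_A3I:
  assumes A: "A \<in> tensor_space V"
    and trace: "\<And>E Z. orthonormal_frame V g E \<Longrightarrow> Z \<in> V \<Longrightarrow> (\<Sum>e\<in>E. A e e Z) = 0"
  shows "A \<in> tensor_sum V (type_A2 V) (type_A3 V g)"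
proof -
  define A2 where "A2 = (\<lambda>X Y Z. (A X Y Z + A Y Z X + A Z X Y) / 3)"
  define A3 where "A3 = (\<lambda>X Y Z. A X Y Z - A2 X Y Z)"
  have A2: "A2 \<in> type_A2 V"
    unfolding A2_def by (rule tensor_space_cyclic_mean[OF A])
  have "A3 \<in> tensor_space V"
    unfolding A3_def by (rule tensor_space_diff[OF A]) (use A2 in \<open>simp add: type_A2_def\<close>)
  moreover have "A3 X Y Z + A3 Y Z X + A3 Z X Y = 0" for X Y Z
    by (simp add: A3_def A2_def field_simps)
  moreover have "(\<Sum>e\<in>E. A3 e e Z) = 0" if E: "orthonormal_frame V g E" and Z: "Z \<in> V" for E Z
  proof -
    have "A2 e e Z = 0" if "e \<in> E" for e
    proof -
      have "e \<in> V" using E that span_base by (auto simp: orthonormal_frame_def)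
      then have "A2 e e Z + A2 e e Z = 0"
        using A2 Z by (simp add: type_A2_def)
      then show ?thesis by simp
    qed
    then show ?thesis
      using trace[OF E Z] by (simp add: A3_def)
  qed
  ultimately have "A3 \<in> type_A3 V g"
    by (simp add: type_A3_def)
  then show ?thesis
    using A2 unfolding tensor_sum_def A3_def
    by (intro CollectI bexI[of _ A2] bexI[of _ "\<lambda>X Y Z. A X Y Z - A2 X Y Z"]) auto
qed

lemma linear_on_set_cong:
  assumes "subspace V" "\<And>X. X \<in> V \<Longrightarrow> f X = g X" "linear_on_set V f"
  shows "linear_on_set V g"
  using assms unfolding linear_on_set_def by (simp add: subspace_add subspace_scale)

lemma tensor_space_cong:
  assumes V: "subspace V" and eq: "\<And>X Y Z. X \<in> V \<Longrightarrow> Y \<in> V \<Longrightarrow> Z \<in> V \<Longrightarrow> A X Y Z = A' X Y Z"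
    and A: "A \<in> tensor_space V"
  shows "A' \<in> tensor_space V"
proof -
  have "linear_on_set V (\<lambda>X. A' X Y Z)" "linear_on_set V (\<lambda>X. A' Y X Z)" "linear_on_set V (\<lambda>X. A' Y Z X)"
    if "Y \<in> V" "Z \<in> V" for Y Z
    using that A
      linear_on_set_cong[OF V, of "\<lambda>X. A X Y Z" "\<lambda>X. A' X Y Z"]
      linear_on_set_cong[OF V, of "\<lambda>X. A Y X Z" "\<lambda>X. A' Y X Z"]
      linear_on_set_cong[OF V, of "\<lambda>X. A Y Z X" "\<lambda>X. A' Y Z X"]
    by (simp_all add: tensor_space_def eq)
  moreover have "A' X Y Z + A' X Z Y = 0" if "X \<in> V" "Y \<in> V" "Z \<in> V" for X Y Z
    using that A by (simp add: tensor_space_def eq[symmetric])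
  ultimately show ?thesis
    by (simp add: tensor_space_def)
qed

section \<open>Reductive decompositions with two summands\<close>

lemma component_eq:
  assumes "subspace V" "subspace W" "V \<inter> W = {0}" "u \<in> V" "w \<in> W"
  shows "component V W (u + w) = u"
  unfolding component_def
proof (rule the_equality)
  show "u \<in> V \<and> u + w - u \<in> W" using assms by simp
next
  fix v assume v: "v \<in> V \<and> u + w - v \<in> W"
  then have "(u + w - v) - w \<in> W" "u - v \<in> V"
    using assms subspace_diff by blast+
  then have "u - v \<in> V \<inter> W"
    by simp
  then show "v = u"
    unfolding assms(3) by simp
qed

text \<open>The algebraic content of the geometric situation: \<open>\<rho>\<close> stands for the adjoint action of \<open>K\<close>
and \<open>B\<close> for the negative of the Killing form.\<close>

locale two_summand_reductive_pair =
  fixes br :: "'v::real_vector \<Rightarrow> 'v \<Rightarrow> 'v" and B :: "'v \<Rightarrow> 'v \<Rightarrow> real"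
    and \<kk> \<mm> \<mm>1 \<mm>2 :: "'v set" and \<rho> :: "'g \<Rightarrow> 'v \<Rightarrow> 'v" and K :: "'g set"
  assumes bilinear_br: "bilinear br" and br_antisym: "br X Y = - br Y X"
    and bilinear_B: "bilinear B" and B_sym: "B X Y = B Y X"
    and B_ad_invariant: "B (br X Y) Z = - B Y (br X Z)"
    and reductive: "direct_sum_decomp UNIV \<kk> \<mm>" and split: "direct_sum_decomp \<mm> \<mm>1 \<mm>2"
    and B_\<kk>_\<mm>: "X \<in> \<kk> \<Longrightarrow> Y \<in> \<mm> \<Longrightarrow> B X Y = 0"
    and br_\<mm>1_\<mm>1: "X \<in> \<mm>1 \<Longrightarrow> Y \<in> \<mm>1 \<Longrightarrow> br X Y \<in> \<kk> + \<mm>2"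
    and br_\<mm>1_\<mm>2: "X \<in> \<mm>1 \<Longrightarrow> Y \<in> \<mm>2 \<Longrightarrow> br X Y \<in> \<mm>1"
    and br_\<mm>2_\<mm>2: "X \<in> \<mm>2 \<Longrightarrow> Y \<in> \<mm>2 \<Longrightarrow> br X Y \<in> \<kk>"
    and linear_\<rho>: "k \<in> K \<Longrightarrow> linear (\<rho> k)"
    and \<rho>_br: "k \<in> K \<Longrightarrow> \<rho> k (br X Y) = br (\<rho> k X) (\<rho> k Y)"
    and \<rho>_\<kk>: "k \<in> K \<Longrightarrow> X \<in> \<kk> \<Longrightarrow> \<rho> k X \<in> \<kk>"
    and \<rho>_\<mm>1: "k \<in> K \<Longrightarrow> X \<in> \<mm>1 \<Longrightarrow> \<rho> k X \<in> \<mm>1"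
    and \<rho>_\<mm>2: "k \<in> K \<Longrightarrow> X \<in> \<mm>2 \<Longrightarrow> \<rho> k X \<in> \<mm>2"
begin

lemmas br_simps = bilinear_ladd[OF bilinear_br] bilinear_radd[OF bilinear_br]
  bilinear_lmul[OF bilinear_br] bilinear_rmul[OF bilinear_br]
lemmas B_simps = bilinear_ladd[OF bilinear_B] bilinear_radd[OF bilinear_B]
  bilinear_lmul[OF bilinear_B] bilinear_rmul[OF bilinear_B]
  bilinear_lzero[OF bilinear_B] bilinear_rzero[OF bilinear_B]

lemma subspaces: "subspace \<kk>" "subspace \<mm>" "subspace \<mm>1" "subspace \<mm>2"
  using reductive split by (auto simp: direct_sum_decomp_def)

lemma \<mm>I: "x1 \<in> \<mm>1 \<Longrightarrow> x2 \<in> \<mm>2 \<Longrightarrow> x1 + x2 \<in> \<mm>"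
  using split unfolding direct_sum_decomp_def by (metis set_plus_intro)

lemma \<mm>1_\<mm>: "X \<in> \<mm>1 \<Longrightarrow> X \<in> \<mm>" and \<mm>2_\<mm>: "X \<in> \<mm>2 \<Longrightarrow> X \<in> \<mm>"
  using \<mm>I[of X 0] \<mm>I[of 0 X] subspaces subspace_0 by auto

text \<open>\<open>P1\<close> and \<open>P2\<close> are meaningful on \<^term>\<open>\<mm>\<close> only, whereas \<open>Q2\<close> also extracts the
\<^term>\<open>\<mm>2\<close>-component of vectors with a part in \<^term>\<open>\<kk>\<close>, such as brackets.\<close>

abbreviation P1 :: "'v \<Rightarrow> 'v" where "P1 \<equiv> component \<mm>1 \<mm>2"
abbreviation P2 :: "'v \<Rightarrow> 'v" where "P2 \<equiv> component \<mm>2 \<mm>1"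
abbreviation Q2 :: "'v \<Rightarrow> 'v" where "Q2 \<equiv> component \<mm>2 (\<kk> + \<mm>1)"

lemma P1_eq: "x1 \<in> \<mm>1 \<Longrightarrow> x2 \<in> \<mm>2 \<Longrightarrow> P1 (x1 + x2) = x1"
  using component_eq[of \<mm>1 \<mm>2] split by (auto simp: direct_sum_decomp_def)

lemma P2_eq: "x1 \<in> \<mm>1 \<Longrightarrow> x2 \<in> \<mm>2 \<Longrightarrow> P2 (x1 + x2) = x2"
  using component_eq[of \<mm>2 \<mm>1 x2 x1] split by (auto simp: direct_sum_decomp_def add.commute Int_commute)

lemma \<mm>_cases:
  assumes "X \<in> \<mm>"
  obtains x1 x2 where "x1 \<in> \<mm>1" "x2 \<in> \<mm>2" "X = x1 + x2"
  using assms split unfolding direct_sum_decomp_def by (metis set_plus_elim)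

lemma P1_in: "X \<in> \<mm> \<Longrightarrow> P1 X \<in> \<mm>1" and P2_in: "X \<in> \<mm> \<Longrightarrow> P2 X \<in> \<mm>2"
  and P_sum: "X \<in> \<mm> \<Longrightarrow> P1 X + P2 X = X"
  by (auto elim!: \<mm>_cases simp: P1_eq P2_eq)

lemma P_\<mm>1: "X \<in> \<mm>1 \<Longrightarrow> P1 X = X" "X \<in> \<mm>1 \<Longrightarrow> P2 X = 0"
  using P1_eq[of X 0] P2_eq[of X 0] subspaces subspace_0 by auto

lemma P_\<mm>2: "X \<in> \<mm>2 \<Longrightarrow> P1 X = 0" "X \<in> \<mm>2 \<Longrightarrow> P2 X = X"
  using P1_eq[of 0 X] P2_eq[of 0 X] subspaces subspace_0 by auto

lemma P_eqI:
  assumes "X = x1 + x2" "x1 \<in> \<mm>1" "x2 \<in> \<mm>2" shows "P1 X = x1" "P2 X = x2"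
  using assms P1_eq P2_eq by auto

lemma P_add:
  assumes "X \<in> \<mm>" "Y \<in> \<mm>" shows "P1 (X + Y) = P1 X + P1 Y" "P2 (X + Y) = P2 X + P2 Y"
proof -
  have "X + Y = (P1 X + P1 Y) + (P2 X + P2 Y)"
    using P_sum[OF assms(1)] P_sum[OF assms(2)] by (metis add.commute add.left_commute)
  then show "P1 (X + Y) = P1 X + P1 Y" "P2 (X + Y) = P2 X + P2 Y"
    using P_eqI[of "X + Y"] P1_in P2_in assms subspaces subspace_add by metis+
qed

lemma P_scale:
  assumes "X \<in> \<mm>" shows "P1 (r *\<^sub>R X) = r *\<^sub>R P1 X" "P2 (r *\<^sub>R X) = r *\<^sub>R P2 X"
proof -
  have "r *\<^sub>R X = r *\<^sub>R P1 X + r *\<^sub>R P2 X"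
    using P_sum[OF assms] by (metis scaleR_add_right)
  then show "P1 (r *\<^sub>R X) = r *\<^sub>R P1 X" "P2 (r *\<^sub>R X) = r *\<^sub>R P2 X"
    using P_eqI[of "r *\<^sub>R X"] P1_in P2_in assms subspaces subspace_scale by metis+
qed

lemma P_\<rho>:
  assumes "k \<in> K" "X \<in> \<mm>" shows "P1 (\<rho> k X) = \<rho> k (P1 X)" "P2 (\<rho> k X) = \<rho> k (P2 X)"
proof -
  have "\<rho> k X = \<rho> k (P1 X) + \<rho> k (P2 X)"
    using P_sum[OF assms(2)] linear_add[OF linear_\<rho>[OF assms(1)]] by metis
  then show "P1 (\<rho> k X) = \<rho> k (P1 X)" "P2 (\<rho> k X) = \<rho> k (P2 X)"
    using P_eqI[of "\<rho> k X"] P1_in P2_in assms \<rho>_\<mm>1 \<rho>_\<mm>2 by metis+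
qed

text \<open>The sum of \<^term>\<open>\<kk>\<close> and \<^term>\<open>\<mm>1\<close> is a complement of \<^term>\<open>\<mm>2\<close> in the whole algebra, so
\<^term>\<open>Q2\<close> is the corresponding projection, defined on all vectors and not only on \<^term>\<open>\<mm>\<close>.\<close>

lemma Q2_eq:
  assumes "x \<in> \<kk>" "x1 \<in> \<mm>1" "x2 \<in> \<mm>2"
  shows "Q2 (x + x1 + x2) = x2"
proof -
  have sub: "subspace (\<kk> + \<mm>1)"
    by (rule back_subst[of subspace, OF subspace_sums[OF subspaces(1,3)]]) (auto simp: set_plus_def)
  have "\<mm>2 \<inter> (\<kk> + \<mm>1) = {0}"
  proof -
    have "v = 0" if v: "v \<in> \<mm>2" "v \<in> \<kk> + \<mm>1" for v
    proof -
      obtain a b where ab: "a \<in> \<kk>" "b \<in> \<mm>1" "v = a + b"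
        using v(2) by (rule set_plus_elim)
      have "a = v - b" using ab(3) by simp
      then have "a \<in> \<kk> \<inter> \<mm>"
        using ab v(1) \<mm>1_\<mm> \<mm>2_\<mm> subspaces(2) subspace_diff by blast
      then have "a = 0"
        using reductive by (auto simp: direct_sum_decomp_def)
      then have "v \<in> \<mm>1 \<inter> \<mm>2" using ab v by simp
      then show "v = 0"
        using split by (auto simp: direct_sum_decomp_def)
    qed
    then show ?thesis
      using subspace_0[OF sub] subspace_0[OF subspaces(4)] by blast
  qed
  from component_eq[OF subspaces(4) sub this assms(3) set_plus_intro[OF assms(1,2)]]
  show ?thesis by (simp add: add.commute)
qed

lemma decompose:
  obtains x x1 x2 where "x \<in> \<kk>" "x1 \<in> \<mm>1" "x2 \<in> \<mm>2" "X = x + x1 + x2"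
proof -
  have "X \<in> \<kk> + \<mm>" using reductive by (simp add: direct_sum_decomp_def)
  then obtain x y where "x \<in> \<kk>" "y \<in> \<mm>" "X = x + y" by (rule set_plus_elim)
  moreover then obtain x1 x2 where "x1 \<in> \<mm>1" "x2 \<in> \<mm>2" "y = x1 + x2" by (elim \<mm>_cases)
  ultimately show ?thesis using that by (metis add.assoc)
qed

lemma Q2_in: "Q2 X \<in> \<mm>2"
  by (rule decompose[of X]) (simp add: Q2_eq)

lemma Q2_add: "Q2 (X + Y) = Q2 X + Q2 Y"
proof -
  obtain x x1 x2 where X: "x \<in> \<kk>" "x1 \<in> \<mm>1" "x2 \<in> \<mm>2" "X = x + x1 + x2" by (rule decompose)
  obtain y y1 y2 where Y: "y \<in> \<kk>" "y1 \<in> \<mm>1" "y2 \<in> \<mm>2" "Y = y + y1 + y2" by (rule decompose)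
  have "X + Y = (x + y) + (x1 + y1) + (x2 + y2)" using X Y by simp
  then show ?thesis
    using Q2_eq[of "x + y" "x1 + y1" "x2 + y2"] Q2_eq[OF X(1-3)] Q2_eq[OF Y(1-3)] X Y subspaces subspace_add
    by metis
qed

lemma Q2_scale: "Q2 (r *\<^sub>R X) = r *\<^sub>R Q2 X"
proof -
  obtain x x1 x2 where X: "x \<in> \<kk>" "x1 \<in> \<mm>1" "x2 \<in> \<mm>2" "X = x + x1 + x2" by (rule decompose)
  have "r *\<^sub>R X = r *\<^sub>R x + r *\<^sub>R x1 + r *\<^sub>R x2" using X by (simp add: scaleR_add_right)
  then show ?thesis
    using Q2_eq[of "r *\<^sub>R x" "r *\<^sub>R x1" "r *\<^sub>R x2"] Q2_eq[OF X(1-3)] X subspaces subspace_scale by metis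
qed

lemma Q2_\<rho>:
  assumes "k \<in> K" shows "Q2 (\<rho> k X) = \<rho> k (Q2 X)"
proof -
  obtain x x1 x2 where X: "x \<in> \<kk>" "x1 \<in> \<mm>1" "x2 \<in> \<mm>2" "X = x + x1 + x2" by (rule decompose)
  have "\<rho> k X = \<rho> k x + \<rho> k x1 + \<rho> k x2" using X linear_add[OF linear_\<rho>[OF assms]] by simp
  then show ?thesis
    using Q2_eq[of "\<rho> k x" "\<rho> k x1" "\<rho> k x2"] Q2_eq[OF X(1-3)] X \<rho>_\<kk> \<rho>_\<mm>1 \<rho>_\<mm>2 assms by metis
qed

lemma br_\<mm>1_\<mm>1_decomp:
  assumes "X \<in> \<mm>1" "Y \<in> \<mm>1"
  obtains u where "u \<in> \<kk>" "br X Y = u + Q2 (br X Y)"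
proof -
  obtain u v where "u \<in> \<kk>" "v \<in> \<mm>2" "br X Y = u + v"
    using br_\<mm>1_\<mm>1[OF assms] by (rule set_plus_elim)
  then show ?thesis
    using that Q2_eq[of u 0 v] subspace_0[OF subspaces(3)] by auto
qed

lemma br_\<mm>2_\<mm>1: "X \<in> \<mm>2 \<Longrightarrow> Y \<in> \<mm>1 \<Longrightarrow> br X Y \<in> \<mm>1"
  using br_antisym[of X Y] br_\<mm>1_\<mm>2[of Y X] subspace_neg[OF subspaces(3)] by simp

lemma Lambda_t_eq: "Lambda_t br \<kk> \<mm>1 \<mm>2 t X Y =
    (t *\<^sub>R br (P1 X) (P2 Y) + (1 - t) *\<^sub>R br (P2 X) (P1 Y)) + (1/2) *\<^sub>R Q2 (br (P1 X) (P1 Y))"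
  by (simp add: Lambda_t_def Let_def)

lemma Lambda_t_parts:
  assumes "X \<in> \<mm>" "Y \<in> \<mm>"
  shows "t *\<^sub>R br (P1 X) (P2 Y) + (1 - t) *\<^sub>R br (P2 X) (P1 Y) \<in> \<mm>1"
    and "(1/2) *\<^sub>R Q2 (br (P1 X) (P1 Y)) \<in> \<mm>2"
  using P1_in P2_in assms subspaces br_\<mm>1_\<mm>2 br_\<mm>2_\<mm>1 Q2_in
  by (simp_all add: subspace_add subspace_scale)

abbreviation \<Lambda> :: "real \<Rightarrow> real \<Rightarrow> 'v \<Rightarrow> 'v \<Rightarrow> 'v" where
  "\<Lambda> \<equiv> Lambda_st br \<kk> \<mm>1 \<mm>2"

abbreviation g :: "real \<Rightarrow> 'v \<Rightarrow> 'v \<Rightarrow> real" where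
  "g \<equiv> metric_t B \<mm>1 \<mm>2"

lemma Lambda_in: "X \<in> \<mm> \<Longrightarrow> Y \<in> \<mm> \<Longrightarrow> \<Lambda> s t X Y \<in> \<mm>"
  unfolding Lambda_st_def Lambda_t_eq
  by (intro subspace_scale[OF subspaces(2)] \<mm>I Lambda_t_parts)

lemma g_sym: "g t X Y = g t Y X"
  by (simp add: metric_t_def B_sym)

lemma g_linear: "Y \<in> \<mm> \<Longrightarrow> linear_on_set \<mm> (\<lambda>X. g t X Y)"
  by (simp add: linear_on_set_def metric_t_def P_add P_scale B_simps algebra_simps)

lemma nomizu_map_Lambda: "nomizu_map \<rho> K \<mm> (\<Lambda> s t)"
  unfolding nomizu_map_def
proof (intro conjI ballI)
  fix X Y assume "X \<in> \<mm>" "Y \<in> \<mm>"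
  then show "\<Lambda> s t X Y \<in> \<mm>" by (rule Lambda_in)
next
  fix X assume "X \<in> \<mm>"
  show "linear_on_set \<mm> (\<Lambda> s t X)"
    by (simp add: linear_on_set_def Lambda_st_def Lambda_t_eq P_add P_scale br_simps Q2_add Q2_scale
        algebra_simps)
next
  fix Y assume "Y \<in> \<mm>"
  show "linear_on_set \<mm> (\<lambda>X. \<Lambda> s t X Y)"
    by (simp add: linear_on_set_def Lambda_st_def Lambda_t_eq P_add P_scale br_simps Q2_add Q2_scale
        algebra_simps)
next
  fix k X Y assume k: "k \<in> K" and "X \<in> \<mm>" "Y \<in> \<mm>"
  then show "\<Lambda> s t (\<rho> k X) (\<rho> k Y) = \<rho> k (\<Lambda> s t X Y)"
    by (simp add: Lambda_st_def Lambda_t_eq P_\<rho> \<rho>_br[OF k, symmetric] Q2_\<rho>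
        linear_add[OF linear_\<rho>[OF k]] linear_scale[OF linear_\<rho>[OF k]])
qed

text \<open>The trilinear form \<open>g\<^sub>t(\<Lambda>\<^sub>t(X)Y, Z)\<close>, expressed through \<^term>\<open>B\<close> and the bracket alone.\<close>

definition \<omega> :: "real \<Rightarrow> 'v tensor3" where
  "\<omega> t X Y Z = t * (B (br (P1 X) (P2 Y)) (P1 Z) + B (br (P1 X) (P1 Y)) (P2 Z))
     + (1 - t) * B (br (P2 X) (P1 Y)) (P1 Z)"

text \<open>Replacing the \<^term>\<open>\<mm>2\<close>-component of the bracket by the bracket itself costs nothing, since the
discarded part lies in \<^term>\<open>\<kk>\<close>. The factor 1/2 in the Nomizu map and the factor \<open>2 t\<close> in the
metric combine to \<^term>\<open>t\<close>.\<close>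

lemma g_Lambda:
  assumes X: "X \<in> \<mm>" and Y: "Y \<in> \<mm>" and Z: "Z \<in> \<mm>"
  shows "g t (\<Lambda> s t X Y) Z = s * \<omega> t X Y Z"
proof -
  note parts = Lambda_t_parts[OF X Y]
  have P: "P1 (\<Lambda> s t X Y) = s *\<^sub>R (t *\<^sub>R br (P1 X) (P2 Y) + (1 - t) *\<^sub>R br (P2 X) (P1 Y))"
    "P2 (\<Lambda> s t X Y) = s *\<^sub>R (1/2) *\<^sub>R Q2 (br (P1 X) (P1 Y))"
    unfolding Lambda_st_def Lambda_t_eq P_scale[OF \<mm>I[OF parts]] P1_eq[OF parts] P2_eq[OF parts]
    by simp_all
  obtain u where u: "u \<in> \<kk>" "br (P1 X) (P1 Y) = u + Q2 (br (P1 X) (P1 Y))"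
    using br_\<mm>1_\<mm>1_decomp P1_in X Y by metis
  have "B (br (P1 X) (P1 Y)) (P2 Z) = B (u + Q2 (br (P1 X) (P1 Y))) (P2 Z)"
    using u(2) by simp
  also have "\<dots> = B (Q2 (br (P1 X) (P1 Y))) (P2 Z)"
    using B_\<kk>_\<mm>[OF u(1) \<mm>2_\<mm>[OF P2_in[OF Z]]] by (simp add: B_simps)
  finally show ?thesis
    by (simp add: metric_t_def P \<omega>_def B_simps ring_distribs)
qed

text \<open>Invariance under \<open>ad\<close> exchanges, up to sign, the two terms with coefficient \<^term>\<open>t\<close> and maps the term with
coefficient \<open>1 - t\<close> to its negative.\<close>

lemma \<omega>_skew: "\<omega> t X Z Y = - \<omega> t X Y Z"
  using B_ad_invariant[of "P1 X" "P2 Z" "P1 Y"] B_ad_invariant[of "P1 X" "P1 Z" "P2 Y"]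
    B_ad_invariant[of "P2 X" "P1 Z" "P1 Y"] B_sym
  by (simp add: \<omega>_def algebra_simps)

lemma \<omega>_tensor: "\<omega> t \<in> tensor_space \<mm>"
proof (rule tensor_spaceI)
  show "\<omega> t X Z Y = - \<omega> t X Y Z" for X Y Z by (rule \<omega>_skew)
qed (simp_all add: \<omega>_def P_add P_scale br_simps B_simps algebra_simps)

lemma metric_nomizu_map_Lambda: "metric_nomizu_map \<rho> K \<mm> (g t) (\<Lambda> s t)"
proof -
  have "g t (\<Lambda> s t X Y) Z + g t Y (\<Lambda> s t X Z) = 0" if "X \<in> \<mm>" "Y \<in> \<mm>" "Z \<in> \<mm>" for X Y Z
    using that g_Lambda g_sym[of t Y] \<omega>_skew[of t X Z Y] by simp
  then show ?thesis
    by (simp add: metric_nomizu_map_def nomizu_map_Lambda)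
qed

lemma torsion_Lambda_t:
  assumes X: "X \<in> \<mm>" and Y: "Y \<in> \<mm>"
  shows "nomizu_torsion br \<kk> \<mm> (Lambda_t br \<kk> \<mm>1 \<mm>2 t) X Y = 0"
proof -
  obtain u where u: "u \<in> \<kk>" "br (P1 X) (P1 Y) = u + Q2 (br (P1 X) (P1 Y))"
    using br_\<mm>1_\<mm>1_decomp P1_in X Y by metis
  define W where "W = Q2 (br (P1 X) (P1 Y)) + br (P1 X) (P2 Y) + br (P2 X) (P1 Y)"
  have "br X Y = br (P1 X + P2 X) (P1 Y + P2 Y)"
    using P_sum X Y by simp
  also have "\<dots> = br (P1 X) (P1 Y) + br (P1 X) (P2 Y) + br (P2 X) (P1 Y) + br (P2 X) (P2 Y)"
    by (simp add: br_simps)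
  also have "\<dots> = W + (u + br (P2 X) (P2 Y))"
    unfolding W_def by (subst u(2)) simp
  finally have "br X Y = W + (u + br (P2 X) (P2 Y))" .
  moreover have "u + br (P2 X) (P2 Y) \<in> \<kk>"
    using u(1) br_\<mm>2_\<mm>2 P2_in X Y subspaces(1) by (simp add: subspace_add)
  moreover have "W \<in> \<mm>"
    unfolding W_def using X Y
    by (intro subspace_add[OF subspaces(2)] \<mm>1_\<mm>[OF br_\<mm>1_\<mm>2] \<mm>1_\<mm>[OF br_\<mm>2_\<mm>1] \<mm>2_\<mm>[OF Q2_in] P1_in P2_in)
  moreover have "\<mm> \<inter> \<kk> = {0}"
    using reductive by (auto simp: direct_sum_decomp_def)
  ultimately have comp: "component \<mm> \<kk> (br X Y) = W"
    using component_eq[OF subspaces(2,1)] by simp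
  have "Q2 (br (P1 Y) (P1 X)) = - Q2 (br (P1 X) (P1 Y))"
    using Q2_scale[of "-1" "br (P1 X) (P1 Y)"] br_antisym[of "P1 Y" "P1 X"] by simp
  moreover have "br (P1 Y) (P2 X) = - br (P2 X) (P1 Y)" "br (P2 Y) (P1 X) = - br (P1 X) (P2 Y)"
    by (rule br_antisym)+
  ultimately show ?thesis
    unfolding nomizu_torsion_def comp Lambda_t_eq W_def
    by (simp add: algebra_simps flip: scaleR_add_left)
qed

lemma levi_civita_Lambda_t: "levi_civita_nomizu_map \<rho> K br \<kk> \<mm> (g t) (Lambda_t br \<kk> \<mm>1 \<mm>2 t)"
proof -
  have "\<Lambda> 1 t = Lambda_t br \<kk> \<mm>1 \<mm>2 t"
    by (intro ext) (simp add: Lambda_st_def)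
  then show ?thesis
    using metric_nomizu_map_Lambda[of t 1] torsion_Lambda_t by (simp add: levi_civita_nomizu_map_def)
qed

lemma g_Lambda_difference:
  assumes "X \<in> \<mm>" "Y \<in> \<mm>" "Z \<in> \<mm>"
  shows "g t (\<Lambda> s t X Y - Lambda_t br \<kk> \<mm>1 \<mm>2 t X Y) Z = (s - 1) * \<omega> t X Y Z"
proof -
  have "\<Lambda> s t X Y - Lambda_t br \<kk> \<mm>1 \<mm>2 t X Y = \<Lambda> (s - 1) t X Y"
    by (simp add: Lambda_st_def scaleR_diff_left)
  then show ?thesis using g_Lambda[OF assms] by simp
qed

lemma difference_tensor:
  "(\<lambda>X Y Z. g t (\<Lambda> s t X Y - Lambda_t br \<kk> \<mm>1 \<mm>2 t X Y) Z) \<in> tensor_space \<mm>"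
  by (rule tensor_space_cong[OF subspaces(2) _ tensor_space_scale[OF \<omega>_tensor[of t], of "s - 1"]])
     (simp add: g_Lambda_difference)

text \<open>On the diagonal \<^term>\<open>\<omega> t\<close> becomes a multiple of the quadratic form of
\<open>X \<mapsto> br (P2 X) (P1 Z)\<close>, which maps \<^term>\<open>\<mm>2\<close> into \<^term>\<open>\<mm>1\<close> and annihilates \<^term>\<open>\<mm>1\<close>.\<close>

lemma trace_\<omega>:
  assumes E: "orthonormal_frame \<mm> (g t) E" and Z: "Z \<in> \<mm>"
  shows "(\<Sum>e\<in>E. \<omega> t e e Z) = 0"
proof -
  have EV: "e \<in> \<mm>" if "e \<in> E" for e
    using E that span_base by (auto simp: orthonormal_frame_def)
  let ?\<psi> = "\<lambda>X. br (P2 X) (P1 Z)"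
  have \<psi>_in: "?\<psi> X \<in> \<mm>1" if "X \<in> \<mm>" for X
    using that Z br_\<mm>2_\<mm>1 P1_in P2_in by simp
  have "(\<Sum>e\<in>E. g t e (?\<psi> e)) = 0"
  proof (rule orthonormal_frame_trace_offdiagonal[OF E g_linear g_sym, where P = P2])
    fix X Y assume XY: "X \<in> \<mm>" "Y \<in> \<mm>"
    show "g t (P2 X) Y = g t X (P2 Y)"
      using XY P_\<mm>2[OF P2_in] by (simp add: metric_t_def B_simps)
  next
    fix X assume X: "X \<in> \<mm>"
    show "P2 X \<in> \<mm>" by (rule \<mm>2_\<mm>[OF P2_in[OF X]])
    show "?\<psi> X \<in> \<mm>" by (rule \<mm>1_\<mm>[OF \<psi>_in[OF X]])
    show "?\<psi> (P2 X) = ?\<psi> X" using P_\<mm>2[OF P2_in[OF X]] by simp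
    show "g t (P2 X) (?\<psi> X) = 0"
      using P_\<mm>2[OF P2_in[OF X]] P_\<mm>1[OF \<psi>_in[OF X]] by (simp add: metric_t_def B_simps)
  next
    show "linear_on_set \<mm> ?\<psi>"
      by (simp add: linear_on_set_def P_add P_scale br_simps)
  qed
  moreover have "\<omega> t e e Z = (2 * t - 1) * g t e (?\<psi> e)" if "e \<in> E" for e
  proof -
    have "g t e (?\<psi> e) = B (P1 e) (br (P2 e) (P1 Z))"
      using P_\<mm>1[OF \<psi>_in[OF EV[OF that]]] by (simp add: metric_t_def B_simps)
    moreover have "B (br (P2 e) (P1 e)) (P1 Z) = - B (P1 e) (br (P2 e) (P1 Z))"
      by (rule B_ad_invariant)
    moreover have "B (br (P1 e) (P2 e)) (P1 Z) = - B (br (P2 e) (P1 e)) (P1 Z)"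
      using br_antisym[of "P1 e" "P2 e"] bilinear_lneg[OF bilinear_B] by simp
    moreover have "br (P1 e) (P1 e) = 0"
    proof -
      have "br (P1 e) (P1 e) + br (P1 e) (P1 e) = 0"
        using br_antisym[of "P1 e" "P1 e"] by (rule iffD1[OF eq_neg_iff_add_eq_0])
      then have "2 *\<^sub>R br (P1 e) (P1 e) = 0"
        by (simp only: scaleR_2)
      then show ?thesis by simp
    qed
    ultimately show ?thesis
      by (simp add: \<omega>_def B_simps algebra_simps)
  qed
  ultimately show ?thesis
    by (simp add: sum_distrib_left[symmetric])
qed

theorem torsion_mixed_type:
  "torsion_of_type \<rho> K br \<kk> \<mm> (g t) (tensor_sum \<mm> (type_A2 \<mm>) (type_A3 \<mm> (g t))) (\<Lambda> s t)"
proof -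
  have "(\<Sum>e\<in>E. g t (\<Lambda> s t e e - Lambda_t br \<kk> \<mm>1 \<mm>2 t e e) Z) = 0"
    if E: "orthonormal_frame \<mm> (g t) E" and Z: "Z \<in> \<mm>" for E Z
  proof -
    have "e \<in> \<mm>" if "e \<in> E" for e
      using E that span_base by (auto simp: orthonormal_frame_def)
    then have "(\<Sum>e\<in>E. g t (\<Lambda> s t e e - Lambda_t br \<kk> \<mm>1 \<mm>2 t e e) Z) = (\<Sum>e\<in>E. (s - 1) * \<omega> t e e Z)"
      using Z by (intro sum.cong) (simp_all add: g_Lambda_difference)
    then show ?thesis
      using trace_\<omega>[OF E Z] by (simp add: sum_distrib_left[symmetric])
  qed
  from tensor_A2_A3I[OF difference_tensor this]
  show ?thesis
    unfolding torsion_of_type_def using levi_civita_Lambda_t by blast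
qed

theorem torsion_skew_type:
  "torsion_of_type \<rho> K br \<kk> \<mm> (g (1/2)) (type_A2 \<mm>) (\<Lambda> s (1/2))"
proof -
  have "\<omega> (1/2) X Y Z + \<omega> (1/2) Y X Z = 0" for X Y Z
  proof -
    have "B (br (P1 Y) (P2 X)) (P1 Z) = - B (br (P2 X) (P1 Y)) (P1 Z)"
      "B (br (P2 Y) (P1 X)) (P1 Z) = - B (br (P1 X) (P2 Y)) (P1 Z)"
      "B (br (P1 Y) (P1 X)) (P2 Z) = - B (br (P1 X) (P1 Y)) (P2 Z)"
      using bilinear_lneg[OF bilinear_B] br_antisym by metis+
    then show ?thesis
      by (simp add: \<omega>_def field_simps)
  qed
  then have "(s - 1) * \<omega> (1/2) X Y Z + (s - 1) * \<omega> (1/2) Y X Z = 0" for X Y Z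
    by (simp only: distrib_left[symmetric] mult_zero_right)
  then have "(\<lambda>X Y Z. g (1/2) (\<Lambda> s (1/2) X Y - Lambda_t br \<kk> \<mm>1 \<mm>2 (1/2) X Y) Z) \<in> type_A2 \<mm>"
    using difference_tensor[of "1/2" s] by (simp add: type_A2_def g_Lambda_difference)
  then show ?thesis
    unfolding torsion_of_type_def using levi_civita_Lambda_t by blast
qed

end

section \<open>The torsion of the two-parameter family\<close>

theorem theorem5p6:
  fixes G :: "'g monoid" and T :: "'g topology" and \<A> :: "('g, 'd::finite) chart set"
    and c :: "('g, 'd) chart" and K :: "'g set"
    and br :: "real^'d \<Rightarrow> real^'d \<Rightarrow> real^'d" and B :: "real^'d \<Rightarrow> real^'d \<Rightarrow> real"
    and \<rho> :: "'g \<Rightarrow> real^'d \<Rightarrow> real^'d"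
    and \<kk> \<mm> \<mm>1 \<mm>2 :: "(real^'d) set"
  assumes G: "lie_group G T \<A>" "compact_space T" "connected_space T"
    and chart: "c \<in> \<A>" "\<one>\<^bsub>G\<^esub> \<in> fst c"
    and br: "br = lie_bracket G c"
    and semisimple: "semisimple_bracket br"
    and K: "subgroup K G" "closedin T K" "connectedin T K"
    and \<rho>: "\<rho> = adjoint_rep G c"
    and B: "B = (\<lambda>X Y. - killing_form br X Y)"
    and \<kk>: "\<kk> = lie_algebra_of G c K"
    and \<mm>: "\<mm> = {X. \<forall>Y\<in>\<kk>. B X Y = 0}"
    and reductive: "direct_sum_decomp UNIV \<kk> \<mm>"
    and dim_M: "dim \<mm> \<ge> 3"
    and split: "direct_sum_decomp \<mm> \<mm>1 \<mm>2" "\<forall>X\<in>\<mm>1. \<forall>Y\<in>\<mm>2. B X Y = 0"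
    and irreducible: "irreducible_submodule \<rho> K \<mm>1" "irreducible_submodule \<rho> K \<mm>2"
    and inequivalent: "\<not> equivalent_submodules \<rho> K \<mm>1 \<mm>2"
    and k_m1: "\<forall>X\<in>\<kk>. \<forall>Y\<in>\<mm>1. br X Y \<in> \<mm>1"
    and k_m2: "\<forall>X\<in>\<kk>. \<forall>Y\<in>\<mm>2. br X Y \<in> \<mm>2"
    and m1_m1: "\<forall>X\<in>\<mm>1. \<forall>Y\<in>\<mm>1. br X Y \<in> \<kk> + \<mm>2"
    and m1_m2: "\<forall>X\<in>\<mm>1. \<forall>Y\<in>\<mm>2. br X Y \<in> \<mm>1"
    and m2_m2: "\<forall>X\<in>\<mm>2. \<forall>Y\<in>\<mm>2. br X Y \<in> \<kk>"
  shows "(\<forall>s t. t > 0 \<and> t \<noteq> 1/2 \<longrightarrow>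
            metric_nomizu_map \<rho> K \<mm> (metric_t B \<mm>1 \<mm>2 t) (Lambda_st br \<kk> \<mm>1 \<mm>2 s t) \<and>
            torsion_of_type \<rho> K br \<kk> \<mm> (metric_t B \<mm>1 \<mm>2 t)
              (tensor_sum \<mm> (type_A2 \<mm>) (type_A3 \<mm> (metric_t B \<mm>1 \<mm>2 t)))
              (Lambda_st br \<kk> \<mm>1 \<mm>2 s t)) \<and>
         (\<forall>s. metric_nomizu_map \<rho> K \<mm> (metric_t B \<mm>1 \<mm>2 (1/2)) (Lambda_st br \<kk> \<mm>1 \<mm>2 s (1/2)) \<and>
            torsion_of_type \<rho> K br \<kk> \<mm> (metric_t B \<mm>1 \<mm>2 (1/2)) (type_A2 \<mm>)
              (Lambda_st br \<kk> \<mm>1 \<mm>2 s (1/2)))"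
proof -
  interpret lie_group_chart G T \<A> c
    using G(1) chart by (simp add: lie_group_chart_def lie_group_chart_axioms_def)
  have bil: "bilinear br"
    unfolding br lie_bracket_eq by (rule bilinear_bracket)
  have anti: "br X Y = - br Y X" for X Y
    unfolding br lie_bracket_eq by (rule bracket_antisym)
  have jacobi: "br (br X Y) Z + br (br Y Z) X + br (br Z X) Y = 0" for X Y Z
    unfolding br lie_bracket_eq by (rule bracket_jacobi)
  have B_sym: "B X Y = B Y X" for X Y
    unfolding B using killing_form_sym[OF bil] by simp
  have bilinear_B: "bilinear B"
    unfolding B bilinear_def
    using linear_compose_neg[OF linear_bilinear_right[OF bilinear_killing_form[OF bil]]]
      linear_compose_neg[OF linear_bilinear_left[OF bilinear_killing_form[OF bil]]] by simp
  have carrier: "k \<in> carrier G" and inv_in: "inv\<^bsub>G\<^esub> k \<in> K" if "k \<in> K" for k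
    using that subgroup.mem_carrier[OF K(1)] subgroup.m_inv_closed[OF K(1)] by auto
  have linear_\<rho>: "linear (\<rho> k)" and \<rho>_br: "\<rho> k (br X Y) = br (\<rho> k X) (\<rho> k Y)"
    and \<rho>_inv: "\<rho> (inv\<^bsub>G\<^esub> k) (\<rho> k X) = X" "\<rho> k (\<rho> (inv\<^bsub>G\<^esub> k) X) = X" if "k \<in> K" for k X Y
    using linear_adjoint_rep[OF carrier[OF that]] adjoint_rep_bracket[OF carrier[OF that], of X Y]
      adjoint_rep_inverse[OF carrier[OF that]]
      adjoint_rep_inverse[OF carrier[OF inv_in[OF that]]] carrier[OF that]
    by (simp_all add: \<rho> br)
  have B_\<rho>: "B (\<rho> k X) (\<rho> k Y) = B X Y" if k: "k \<in> K" for k X Y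
  proof -
    have "killing_form br (\<rho> k X) (\<rho> k Y) = killing_form br X Y"
      by (rule killing_form_automorphism[where f = "\<rho> k" and f' = "\<rho> (inv\<^bsub>G\<^esub> k)"])
         (fact bil linear_\<rho>[OF k] linear_\<rho>[OF inv_in[OF k]] \<rho>_inv[OF k] \<rho>_br[OF k])+
    then show ?thesis by (simp only: B)
  qed
  have \<rho>_\<mm>1: "\<rho> k X \<in> \<mm>1" if "k \<in> K" "X \<in> \<mm>1" for k X
    using irreducible(1) that by (simp add: irreducible_submodule_def submodule_under_def)
  have \<rho>_\<mm>2: "\<rho> k X \<in> \<mm>2" if "k \<in> K" "X \<in> \<mm>2" for k X
    using irreducible(2) that by (simp add: irreducible_submodule_def submodule_under_def)
  have \<rho>_\<mm>: "\<rho> k X \<in> \<mm>" if k: "k \<in> K" and X: "X \<in> \<mm>" for k X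
  proof -
    have sum: "\<mm>1 + \<mm>2 = \<mm>"
      using split(1) by (simp add: direct_sum_decomp_def)
    obtain x1 x2 where "x1 \<in> \<mm>1" "x2 \<in> \<mm>2" "X = x1 + x2"
      using X unfolding sum[symmetric] by (rule set_plus_elim)
    then have "\<rho> k X = \<rho> k x1 + \<rho> k x2" "\<rho> k x1 \<in> \<mm>1" "\<rho> k x2 \<in> \<mm>2"
      using k \<rho>_\<mm>1 \<rho>_\<mm>2 linear_add[OF linear_\<rho>] by auto
    then show ?thesis
      unfolding sum[symmetric] by (metis set_plus_intro)
  qed
  have sum_UNIV: "\<kk> + \<mm> = UNIV"
    using reductive by (auto simp: direct_sum_decomp_def)
  (* Nondegeneracy of B turns the defining relation of \<mm> around: \<kk> is the orthogonal
     complement of \<mm>, hence inherits the invariance of \<mm>. *)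
  have \<kk>_eq: "X \<in> \<kk>" if orth: "\<And>Y. Y \<in> \<mm> \<Longrightarrow> B X Y = 0" for X
  proof -
    obtain u v where uv: "u \<in> \<kk>" "v \<in> \<mm>" "X = u + v"
      using sum_UNIV by (metis set_plus_elim UNIV_I)
    have "B v Y = 0" for Y
    proof -
      obtain a b where ab: "a \<in> \<kk>" "b \<in> \<mm>" "Y = a + b"
        using sum_UNIV by (metis set_plus_elim UNIV_I)
      have "B v a = 0" "B b u = 0"
        using uv ab \<mm> by auto
      moreover have "B X b = B u b + B v b"
        unfolding uv(3) by (rule bilinear_ladd[OF bilinear_B])
      ultimately show ?thesis
        using orth[OF ab(2)] B_sym[of u b] by (simp add: ab(3) bilinear_radd[OF bilinear_B])
    qed
    then have "v = 0"
      using semisimple unfolding semisimple_bracket_def B by simp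
    then show ?thesis using uv by simp
  qed
  have \<rho>_\<kk>: "\<rho> k X \<in> \<kk>" if k: "k \<in> K" and X: "X \<in> \<kk>" for k X
  proof (rule \<kk>_eq)
    fix Y assume "Y \<in> \<mm>"
    then have "B (\<rho> (inv\<^bsub>G\<^esub> k) Y) X = 0"
      using \<rho>_\<mm>[OF inv_in[OF k]] X \<mm> by blast
    then show "B (\<rho> k X) Y = 0"
      using B_\<rho>[OF k, of X "\<rho> (inv\<^bsub>G\<^esub> k) Y"] \<rho>_inv(2)[OF k] B_sym by simp
  qed
  interpret pair: two_summand_reductive_pair br B \<kk> \<mm> \<mm>1 \<mm>2 \<rho> K
  proof (rule two_summand_reductive_pair.intro)
    show "B (br X Y) Z = - B Y (br X Z)" for X Y Z
      unfolding B using killing_form_ad_invariant[OF bil anti jacobi, of X Y Z] by simp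
    show "B X Y = 0" if "X \<in> \<kk>" "Y \<in> \<mm>" for X Y
      using that \<mm> B_sym[of X Y] by simp
    show "br X Y = - br Y X" for X Y by (rule anti)
    show "B X Y = B Y X" for X Y by (rule B_sym)
    show "linear (\<rho> k)" if "k \<in> K" for k by (rule linear_\<rho>[OF that])
  qed (use bil bilinear_B reductive split m1_m1 m1_m2 m2_m2 \<rho>_br \<rho>_\<kk> \<rho>_\<mm>1 \<rho>_\<mm>2 in auto)
  show ?thesis
    using pair.metric_nomizu_map_Lambda pair.torsion_mixed_type pair.torsion_skew_type by blast
qed

end
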